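(* Let $\mathbf{x}\in\mathbb{C}^{n\times 1}$ (parameter vector, with components $x_1,\dots,x_n$) and $\mathbf{y}\in\mathbb{C}^{m\times 1}$ (measurement vector) be jointly Gaussian random vectors. Assume that $\mathbf{C}_{\mathbf{y}\mathbf{y}}$ is invertible and that, for every $i$, $\sigma_{x_i}^2>0$ and $\mathbf{C}_{\mathbf{y}x_i}\neq\mathbf{0}$. Consider affine estimators $\hat{\mathbf{x}}=\mathbf{E}\mathbf{y}+\mathbf{c}$ with $\mathbf{E}\in\mathbb{C}^{n\times m}$, $\mathbf{c}\in\mathbb{C}^{n\times 1}$, and let $\hat{x}_i$ be the $i$-th component of $\hat{\mathbf{x}}$. Then the CWCU LMMSE estimator, i.e. the affine estimator that, for each $i=1,\dots,n$, minimizes the Bayesian MSE $E_{\mathbf{y},\mathbf{x}}[|\hat{x}_i-x_i|^2]$ under the constraint $E_{\mathbf{y}|x_i}[\hat{x}_i|x_i]=x_i$ (for all possible $x_i$), is given by $$\hat{\mathbf{x}}_{\mathrm{CL}}=E_{\mathbf{x}}[\mathbf{x}]+\mathbf{E}_{\mathrm{CL}}(\mathbf{y}-E_{\mathbf{y}}[\mathbf{y}]),\qquad \mathbf{E}_{\mathrm{CL}}=\mathbf{D}\,\mathbf{C}_{\mathbf{x}\mathbf{y}}\mathbf{C}_{\mathbf{y}\mathbf{y}}^{-1},$$ where $\mathbf{D}$ is the real diagonal $n\times n$ matrix with elements $$[\mathbf{D}]_{i,i}=\frac{\sigma_{x_i}^2}{\mathbf{C}_{x_i\mathbf{y}}\mathbf{C}_{\mathbf{y}\mathbf{y}}^{-1}\mathbf{C}_{\mathbf{y}x_i}}.$$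 Moreover, the error $\mathbf{x}-\hat{\mathbf{x}}_{\mathrm{CL}}$ has mean zero (with respect to the joint distribution of $\mathbf{x}$ and $\mathbf{y}$), and its covariance matrix $\mathbf{C}_{\mathbf{e}\mathbf{e},\mathrm{CL}}$, which is also the minimum Bayesian MSE matrix $\mathbf{M}_{\hat{\mathbf{x}}_{\mathrm{CL}}}=E_{\mathbf{y},\mathbf{x}}[(\mathbf{x}-\hat{\mathbf{x}}_{\mathrm{CL}})(\mathbf{x}-\hat{\mathbf{x}}_{\mathrm{CL}})^H]$, is $$\mathbf{C}_{\mathbf{e}\mathbf{e},\mathrm{CL}}=\mathbf{M}_{\hat{\mathbf{x}}_{\mathrm{CL}}}=\mathbf{C}_{\mathbf{x}\mathbf{x}}-\mathbf{A}\mathbf{D}-\mathbf{D}\mathbf{A}+\mathbf{D}\mathbf{A}\mathbf{D},\qquad \mathbf{A}=\mathbf{C}_{\mathbf{x}\mathbf{y}}\mathbf{C}_{\mathbf{y}\mathbf{y}}^{-1}\mathbf{C}_{\mathbf{y}\mathbf{x}}.$$ The minimum Bayesian MSEs are $\mathrm{Bmse}(\hat{x}_{\mathrm{CL},i})=E_{\mathbf{y},\mathbf{x}}[|\hat{x}_{\mathrm{CL},i}-x_i|^2]=[\mathbf{M}_{\hat{\mathbf{x}}_{\mathrm{CL}}}]_{i,i}$.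
   Context: $(\cdot)^H$ denotes conjugate transpose. For random vectors $\mathbf{u},\mathbf{v}$, $\mathbf{C}_{\mathbf{u}\mathbf{v}}=E[(\mathbf{u}-E[\mathbf{u}])(\mathbf{v}-E[\mathbf{v}])^H]$; in particular $\mathbf{C}_{x_i\mathbf{y}}$ is a $1\times m$ row vector and $\mathbf{C}_{\mathbf{y}x_i}=\mathbf{C}_{x_i\mathbf{y}}^H$ is an $m\times 1$ column vector. $\sigma_{x_i}^2=E[|x_i-E[x_i]|^2]$ is the variance of $x_i$. The subscript of an expectation operator indicates the distribution over which one averages; $E_{\mathbf{y}|x_i}[\,\cdot\,|x_i]$ is the conditional expectation given $x_i$. "Jointly Gaussian" for complex vectors is meant in the proper sense: the stacked vector $[\mathbf{x}^T,\mathbf{y}^T]^T$ is distributed as $\mathcal{CN}(\boldsymbol{\mu},\mathbf{C})$, i.e. it is complex Gaussian and after subtracting its mean it is circularly symmetric (zero pseudo-covariance). CWCU LMMSE stands for "component-wise conditionally unbiased linear minimum mean square error"; "linear" means affine in $\mathbf{y}$. *)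

theory Defs
  imports "HOL-Probability.Probability"
begin

text \<open>\<open>outer_H u v\<close> is \<open>u v\<^sup>H\<close> and \<open>outer_T u v\<close> is \<open>u v\<^sup>T\<close>; an \<open>n \<times> m\<close> matrix has type
  \<^typ>\<open>complex^'m^'n\<close>.\<close>

definition outer_H :: "complex^'n \<Rightarrow> complex^'m \<Rightarrow> complex^'m^'n" where
  "outer_H u v = (\<chi> i j. u $ i * cnj (v $ j))"

definition outer_T :: "complex^'n \<Rightarrow> complex^'m \<Rightarrow> complex^'m^'n" where
  "outer_T u v = (\<chi> i j. u $ i * v $ j)"

definition mean :: "'w measure \<Rightarrow> ('w \<Rightarrow> complex^'n) \<Rightarrow> complex^'n" where
  "mean M u = (LINT \<omega>|M. u \<omega>)"

definition cov_mat ::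
  "'w measure \<Rightarrow> ('w \<Rightarrow> complex^'n) \<Rightarrow> ('w \<Rightarrow> complex^'m) \<Rightarrow> complex^'m^'n" where
  "cov_mat M u v = (LINT \<omega>|M. outer_H (u \<omega> - mean M u) (v \<omega> - mean M v))"

definition pseudo_cov_mat :: "'w measure \<Rightarrow> ('w \<Rightarrow> complex^'n) \<Rightarrow> complex^'n^'n" where
  "pseudo_cov_mat M u = (LINT \<omega>|M. outer_T (u \<omega> - mean M u) (u \<omega> - mean M u))"

definition variance_c :: "'w measure \<Rightarrow> ('w \<Rightarrow> complex) \<Rightarrow> real" where
  "variance_c M u = (LINT \<omega>|M. (cmod (u \<omega> - (LINT \<omega>'|M. u \<omega>')))\<^sup>2)"

text \<open>The scalar component \<open>x\<^sub>i\<close>, once as a complex random variable and once as a one-dimensional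
  random vector, so that \<open>cov_mat M (comp_vec x i) y\<close> is a \<open>1 \<times> m\<close> row and
  \<open>cov_mat M y (comp_vec x i)\<close> an \<open>m \<times> 1\<close> column.\<close>

definition component :: "('w \<Rightarrow> complex^'n) \<Rightarrow> 'n \<Rightarrow> 'w \<Rightarrow> complex" where
  "component x i = (\<lambda>\<omega>. x \<omega> $ i)"

definition comp_vec :: "('w \<Rightarrow> complex^'n) \<Rightarrow> 'n \<Rightarrow> 'w \<Rightarrow> complex^1" where
  "comp_vec x i = (\<lambda>\<omega>. vec (x \<omega> $ i))"

text \<open>Point masses count as Gaussian, so that singular covariance matrices are allowed.\<close>

definition gaussian_real :: "'w measure \<Rightarrow> ('w \<Rightarrow> real) \<Rightarrow> bool" where
  "gaussian_real M X \<longleftrightarrow> X \<in> borel_measurable M \<and>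
     ((\<exists>\<mu> \<sigma>. \<sigma> > 0 \<and> distributed M lborel X (normal_density \<mu> \<sigma>)) \<or>
      (\<exists>\<mu>. AE \<omega> in M. X \<omega> = \<mu>))"

text \<open>Gaussianity of a random vector: every real linear functional of it is Gaussian. The inner
  product of \<^typ>\<open>complex^'k\<close> is the real one, \<open>Re (a\<^sup>H z)\<close>, so for this type the condition says that
  the real and imaginary parts of all components are jointly Gaussian.\<close>

definition gaussian_vec :: "'w measure \<Rightarrow> ('w \<Rightarrow> 'a::euclidean_space) \<Rightarrow> bool" where
  "gaussian_vec M Z \<longleftrightarrow> Z \<in> borel_measurable M \<and> (\<forall>a. gaussian_real M (\<lambda>\<omega>. a \<bullet> Z \<omega>))"

definition proper_gaussian :: "'w measure \<Rightarrow> ('w \<Rightarrow> complex^'k) \<Rightarrow> bool" where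
  "proper_gaussian M Z \<longleftrightarrow> gaussian_vec M Z \<and> pseudo_cov_mat M Z = 0"

definition stack :: "complex^'n \<Rightarrow> complex^'m \<Rightarrow> complex^('n + 'm)" where
  "stack u v = (\<chi> k. case k of Inl i \<Rightarrow> u $ i | Inr j \<Rightarrow> v $ j)"

definition jointly_proper_gaussian ::
  "'w measure \<Rightarrow> ('w \<Rightarrow> complex^'n) \<Rightarrow> ('w \<Rightarrow> complex^'m) \<Rightarrow> bool" where
  "jointly_proper_gaussian M x y \<longleftrightarrow> proper_gaussian M (\<lambda>\<omega>. stack (x \<omega>) (y \<omega>))"

text \<open>The library's conditional expectation is real-valued; real and imaginary parts are
  conditioned separately on the \<open>\<sigma>\<close>-algebra generated by \<open>g\<close>.\<close>

definition cond_exp_given :: "'w measure \<Rightarrow> ('w \<Rightarrow> complex) \<Rightarrow> ('w \<Rightarrow> complex) \<Rightarrow> 'w \<Rightarrow> complex" where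
  "cond_exp_given M g f = (\<lambda>\<omega>.
     Complex (real_cond_exp M (vimage_algebra (space M) g borel) (\<lambda>\<omega>'. Re (f \<omega>')) \<omega>)
             (real_cond_exp M (vimage_algebra (space M) g borel) (\<lambda>\<omega>'. Im (f \<omega>')) \<omega>))"

text \<open>An estimator is a map \<open>g\<close> from measurements to parameters, with estimate \<open>g (y \<omega>)\<close>.\<close>

definition affine_estimator :: "(complex^'m \<Rightarrow> complex^'n) \<Rightarrow> bool" where
  "affine_estimator g \<longleftrightarrow>
     (\<exists>(E :: complex^'m^'n) (c :: complex^'n). \<forall>v. g v = E *v v + c)"

definition bmse ::
  "'w measure \<Rightarrow> ('w \<Rightarrow> complex^'n) \<Rightarrow> ('w \<Rightarrow> complex^'m) \<Rightarrow> (complex^'m \<Rightarrow> complex^'n) \<Rightarrow> 'n \<Rightarrow> real" where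
  "bmse M x y g i = (LINT \<omega>|M. (cmod (g (y \<omega>) $ i - x \<omega> $ i))\<^sup>2)"

definition cond_unbiased ::
  "'w measure \<Rightarrow> ('w \<Rightarrow> complex^'n) \<Rightarrow> ('w \<Rightarrow> complex^'m) \<Rightarrow> (complex^'m \<Rightarrow> complex^'n) \<Rightarrow> 'n \<Rightarrow> bool" where
  "cond_unbiased M x y g i \<longleftrightarrow>
     (AE \<omega> in M. cond_exp_given M (component x i) (\<lambda>\<omega>'. g (y \<omega>') $ i) \<omega> = x \<omega> $ i)"

definition is_cwcu_lmmse ::
  "'w measure \<Rightarrow> ('w \<Rightarrow> complex^'n) \<Rightarrow> ('w \<Rightarrow> complex^'m) \<Rightarrow> (complex^'m \<Rightarrow> complex^'n) \<Rightarrow> bool" where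
  "is_cwcu_lmmse M x y g \<longleftrightarrow> affine_estimator g \<and>
     (\<forall>i. cond_unbiased M x y g i \<and>
          (\<forall>h. affine_estimator h \<and> cond_unbiased M x y h i \<longrightarrow> bmse M x y g i \<le> bmse M x y h i))"

definition mse_mat ::
  "'w measure \<Rightarrow> ('w \<Rightarrow> complex^'n) \<Rightarrow> ('w \<Rightarrow> complex^'m) \<Rightarrow> (complex^'m \<Rightarrow> complex^'n) \<Rightarrow> complex^'n^'n" where
  "mse_mat M x y g = (LINT \<omega>|M. outer_H (x \<omega> - g (y \<omega>)) (x \<omega> - g (y \<omega>)))"

definition D_CL ::
  "'w measure \<Rightarrow> ('w \<Rightarrow> complex^'n) \<Rightarrow> ('w \<Rightarrow> complex^'m) \<Rightarrow> complex^'n^'n" where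
  "D_CL M x y = (\<chi> i j. if i = j
     then of_real (variance_c M (component x i)) /
          (cov_mat M (comp_vec x i) y ** matrix_inv (cov_mat M y y) ** cov_mat M y (comp_vec x i)) $ 1 $ 1
     else 0)"

definition E_CL ::
  "'w measure \<Rightarrow> ('w \<Rightarrow> complex^'n) \<Rightarrow> ('w \<Rightarrow> complex^'m) \<Rightarrow> complex^'m^'n" where
  "E_CL M x y = D_CL M x y ** cov_mat M x y ** matrix_inv (cov_mat M y y)"

definition x_CL ::
  "'w measure \<Rightarrow> ('w \<Rightarrow> complex^'n) \<Rightarrow> ('w \<Rightarrow> complex^'m) \<Rightarrow> complex^'m \<Rightarrow> complex^'n" where
  "x_CL M x y = (\<lambda>v. mean M x + E_CL M x y *v (v - mean M y))"

definition A_CL ::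
  "'w measure \<Rightarrow> ('w \<Rightarrow> complex^'n) \<Rightarrow> ('w \<Rightarrow> complex^'m) \<Rightarrow> complex^'n^'n" where
  "A_CL M x y = cov_mat M x y ** matrix_inv (cov_mat M y y) ** cov_mat M y x"

end

theory Submission
  imports Defs
begin

text \<open>
  Fix a component \<open>i\<close> and write \<open>X = x\<^sub>i\<close> with variance \<open>\<sigma>\<^sup>2\<close>, and \<open>Y\<close> for the \<open>i\<close>-th component of an affine
  estimate \<open>F y + c\<close>. Put \<open>\<alpha> = cov(Y, X) / \<sigma>\<^sup>2\<close>. The residual \<open>Y - \<alpha> X\<close> is uncorrelated with \<open>X\<close> by the
  choice of \<open>\<alpha>\<close>, and properness makes its pseudo-covariance with \<open>X\<close> vanish as well; so its real and
  imaginary parts are uncorrelated with those of \<open>X\<close>, and by Gaussianity they are independent of \<open>X\<close>.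
  Hence \<open>E[Y|X] = E[Y] + \<alpha> (X - E[X])\<close> (\<open>cond_exp_given_proper_gaussian\<close>), and the constraint
  \<open>E[Y|X] = X\<close> amounts to two linear equations, \<open>E[Y] = E[X]\<close> and \<open>(F C\<^sub>y\<^sub>x)\<^sub>i\<^sub>i = \<sigma>\<^sup>2\<close>
  (\<open>cond_unbiased_affine_iff\<close>).

  Under these equations the Bayesian MSE of component \<open>i\<close> collapses to \<open>(F C\<^sub>y\<^sub>y F\<^sup>H)\<^sub>i\<^sub>i - \<sigma>\<^sup>2\<close>. What remains
  is to minimize a positive definite quadratic form in the \<open>i\<close>-th row of \<open>F\<close> over an affine hyperplane.
  The \<open>i\<close>-th row of \<open>E\<^sub>C\<^sub>L = D C\<^sub>x\<^sub>y C\<^sub>y\<^sub>y\<^sup>-\<^sup>1\<close> lies on that hyperplane, \<open>D\<close> being exactly the scaling that puts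
  it there, and since \<open>E\<^sub>C\<^sub>L C\<^sub>y\<^sub>y = D C\<^sub>x\<^sub>y\<close> it is \<open>C\<^sub>y\<^sub>y\<close>-orthogonal to every direction within the hyperplane.
  By Pythagoras the excess MSE of a competitor is the variance of the \<open>i\<close>-th component of
  \<open>(F - E\<^sub>C\<^sub>L) y\<close> (\<open>bmse_excess\<close>); it is nonnegative, and as \<open>C\<^sub>y\<^sub>y\<close> is invertible it vanishes only if the
  rows agree. This gives optimality and uniqueness at once, and expanding the error covariance for
  \<open>F = E\<^sub>C\<^sub>L\<close> gives the MSE matrix.

  Independence of uncorrelated jointly Gaussian variables is a statement about characteristic functions
  in several variables. It is reduced to Levy's uniqueness theorem on the real line by replacing one
  exponential at a time by an indicator: reweighting the probability measure by a bounded random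
  variable turns the factorization of an expectation into the equality of two one-dimensional
  distributions (\<open>indicator_factor_of_iexp_factor_real\<close>).
\<close>

section \<open>Square-integrable random vectors\<close>


definition square_integrable :: "'w measure \<Rightarrow> ('w \<Rightarrow> 'a::euclidean_space) \<Rightarrow> bool" where
  "square_integrable M u \<longleftrightarrow> u \<in> borel_measurable M \<and> integrable M (\<lambda>\<omega>. (norm (u \<omega>))\<^sup>2)"

text \<open>Every second moment below (covariance, pseudo-covariance, scalar product) is the expectation of a
  bounded bilinear map of two random vectors, so a single bound \<open>2 \<parallel>u\<parallel> \<parallel>v\<parallel> \<le> \<parallel>u\<parallel>\<^sup>2 + \<parallel>v\<parallel>\<^sup>2\<close> covers them all.\<close>

lemma square_integrable_bounded_bilinear:
  fixes h :: "'a::euclidean_space \<Rightarrow> 'b::euclidean_space \<Rightarrow> 'c::euclidean_space"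
  assumes "bounded_bilinear h" "square_integrable M u" "square_integrable M v"
  shows "integrable M (\<lambda>\<omega>. h (u \<omega>) (v \<omega>))"
proof -
  interpret h: bounded_bilinear h by fact
  have [measurable]: "u \<in> borel_measurable M" "v \<in> borel_measurable M"
    using assms by (simp_all add: square_integrable_def)
  have "continuous_on UNIV (\<lambda>p. h (fst p) (snd p))"
    by (intro h.continuous_on continuous_intros)
  then have "(\<lambda>p. h (fst p) (snd p)) \<in> borel_measurable (borel \<Otimes>\<^sub>M borel)"
    unfolding borel_prod by (rule borel_measurable_continuous_onI)
  then have meas: "(\<lambda>\<omega>. h (u \<omega>) (v \<omega>)) \<in> borel_measurable M"
    using measurable_compose[of "\<lambda>\<omega>. (u \<omega>, v \<omega>)" M "borel \<Otimes>\<^sub>M borel" "\<lambda>p. h (fst p) (snd p)" borel]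
    by simp
  obtain K where K: "K \<ge> 0" "\<And>a b. norm (h a b) \<le> norm a * norm b * K"
    using h.nonneg_bounded by blast
  show ?thesis
  proof (rule Bochner_Integration.integrable_bound)
    show "integrable M (\<lambda>\<omega>. ((norm (u \<omega>))\<^sup>2 + (norm (v \<omega>))\<^sup>2) * K)"
      using assms by (simp add: square_integrable_def)
    have "norm (h a b) \<le> ((norm a)\<^sup>2 + (norm b)\<^sup>2) * K" for a b
    proof -
      have "norm a * norm b \<le> (norm a)\<^sup>2 + (norm b)\<^sup>2"
        using sum_squares_bound[of "norm a" "norm b"] mult_nonneg_nonneg[OF norm_ge_zero norm_ge_zero, of a b] by linarith
      then show ?thesis using K(2)[of a b] mult_right_mono[OF _ K(1)] by (meson order_trans)
    qed
    then show "AE \<omega> in M. norm (h (u \<omega>) (v \<omega>)) \<le> norm (((norm (u \<omega>))\<^sup>2 + (norm (v \<omega>))\<^sup>2) * K)"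
      using K(1) by (intro AE_I2) simp
  qed (rule meas)
qed

lemma (in finite_measure) square_integrable_const: "square_integrable M (\<lambda>\<omega>. c)"
  by (simp add: square_integrable_def)

lemma (in finite_measure) square_integrable_integrable:
  assumes "square_integrable M u"
  shows "integrable M u"
  using square_integrable_bounded_bilinear[OF bounded_bilinear_scaleR square_integrable_const[of "1::real"] assms]
  by simp

lemma square_integrable_add:
  assumes u: "square_integrable M u" and v: "square_integrable M v"
  shows "square_integrable M (\<lambda>\<omega>. u \<omega> + v \<omega>)"
proof -
  note ip = square_integrable_bounded_bilinear[OF bounded_bilinear_inner]
  have "integrable M (\<lambda>\<omega>. u \<omega> \<bullet> u \<omega> + 2 * (u \<omega> \<bullet> v \<omega>) + v \<omega> \<bullet> v \<omega>)"
    using ip[OF u u] ip[OF u v] ip[OF v v] by simp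
  moreover have "u \<in> borel_measurable M" "v \<in> borel_measurable M"
    using u v by (simp_all add: square_integrable_def)
  then have "(\<lambda>\<omega>. u \<omega> + v \<omega>) \<in> borel_measurable M"
    by (rule borel_measurable_add)
  ultimately show ?thesis
    by (simp add: square_integrable_def power2_norm_eq_inner inner_add inner_commute ac_simps)
qed

lemma square_integrable_linear:
  fixes f :: "'a::euclidean_space \<Rightarrow> 'b::euclidean_space"
  assumes f: "linear f" and u: "square_integrable M u"
  shows "square_integrable M (\<lambda>\<omega>. f (u \<omega>))"
proof -
  have "bounded_bilinear (\<lambda>a b. f a \<bullet> f b)"
    using f by (intro bounded_bilinear.comp[OF bounded_bilinear_inner]) (simp_all add: linear_conv_bounded_linear)
  from square_integrable_bounded_bilinear[OF this u u]
  have "integrable M (\<lambda>\<omega>. (norm (f (u \<omega>)))\<^sup>2)" by (simp add: power2_norm_eq_inner)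
  moreover have "f \<in> borel_measurable borel"
    using f by (intro borel_measurable_continuous_onI linear_continuous_on) (simp add: linear_conv_bounded_linear)
  ultimately show ?thesis
    using u by (auto simp: square_integrable_def)
qed

lemma square_integrable_diff:
  assumes u: "square_integrable M u" and v: "square_integrable M v"
  shows "square_integrable M (\<lambda>\<omega>. u \<omega> - v \<omega>)"
  using square_integrable_add[OF u square_integrable_linear[OF linear_uminus v]] by simp

section \<open>From factorizing characteristic functions to independence\<close>

lemma borel_measurable_cnj [measurable]: "cnj \<in> borel_measurable borel"
  by (intro borel_measurable_continuous_onI continuous_intros)

text \<open>After an affine change \<open>Y\<close> becomes a nonnegative random variable of mean \<open>1\<close>, that is, a probability
  density with respect to the given measure. The hypothesis says that \<open>X\<close> has the same characteristic function
  under the reweighted measure as under the original one, hence, by Levy, the same distribution.\<close>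

lemma (in prob_space) indicator_factor_of_iexp_factor_real:
  fixes X Y :: "'a \<Rightarrow> real"
  assumes X [measurable]: "X \<in> borel_measurable M" and Y [measurable]: "Y \<in> borel_measurable M"
    and bound: "\<And>\<omega>. \<bar>Y \<omega>\<bar> \<le> K"
    and factor: "\<And>t. (CLINT \<omega>|M. of_real (Y \<omega>) * iexp (t * X \<omega>))
                   = of_real (expectation Y) * (CLINT \<omega>|M. iexp (t * X \<omega>))"
    and B: "B \<in> sets borel"
  shows "expectation (\<lambda>\<omega>. Y \<omega> * indicator B (X \<omega>)) = expectation Y * expectation (\<lambda>\<omega>. indicator B (X \<omega>))"
proof -
  have intY: "integrable M Y"
    by (rule integrable_const_bound[of _ K]) (use bound in auto)
  have int_iexp: "integrable M (\<lambda>\<omega>. iexp (t * X \<omega>))" for t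
    by (rule integrable_const_bound[of _ 1]) auto
  have int_Yiexp: "integrable M (\<lambda>\<omega>. of_real (Y \<omega>) * iexp (t * X \<omega>))" for t
    by (rule integrable_const_bound[of _ K]) (use bound in \<open>auto simp: norm_mult\<close>)
  \<comment> \<open>Adding \<open>K\<close> makes \<open>Y\<close> nonnegative; the extra \<open>1\<close> keeps the normalizing mean \<open>k\<close> away from \<open>0\<close>.\<close>
  define k where "k = expectation Y + K + 1"
  define Z where "Z \<omega> = (Y \<omega> + K + 1) / k" for \<omega>
  have [measurable]: "Z \<in> borel_measurable M" unfolding Z_def by simp
  have "expectation (\<lambda>\<omega>. -K) \<le> expectation Y"
    by (rule integral_mono) (use intY bound in \<open>auto simp: abs_le_iff minus_le_iff\<close>)
  then have k: "k \<ge> 1" by (simp add: k_def prob_space)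
  have Z0: "Z \<omega> \<ge> 0" for \<omega>
    using bound[of \<omega>] k by (auto simp: Z_def abs_le_iff)
  have intZ: "integrable M Z" unfolding Z_def using intY by auto
  have EZ: "expectation Z = 1"
    unfolding Z_def using intY k by (simp add: prob_space k_def)
  define N where "N = density M (\<lambda>\<omega>. ennreal (Z \<omega>))"
  have "prob_space N"
    unfolding N_def by (rule prob_spaceI) (simp add: emeasure_density nn_integral_eq_integral intZ Z0 EZ cong: nn_integral_cong_simp)
  interpret N: prob_space N by fact
  have [measurable_cong]: "sets N = sets M" by (simp add: N_def)
  have Ni: "(LINT \<omega>|N. f \<omega>) = (LINT \<omega>|M. Z \<omega> *\<^sub>R f \<omega>)" if [measurable]: "f \<in> borel_measurable M"
    for f :: "'a \<Rightarrow> 'c::{banach, second_countable_topology}"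
    unfolding N_def by (rule integral_density) (auto simp: Z0)
  have "char (distr N borel X) = char (distr M borel X)"
  proof
    fix t
    have "char (distr N borel X) t = (CLINT \<omega>|N. iexp (t * X \<omega>))"
      unfolding char_def by (subst integral_distr) auto
    also have "\<dots> = (CLINT \<omega>|M. Z \<omega> *\<^sub>R iexp (t * X \<omega>))"
      by (rule Ni) simp
    also have "\<dots> = (CLINT \<omega>|M. (of_real (Y \<omega>) * iexp (t * X \<omega>) + of_real (K + 1) * iexp (t * X \<omega>)) / of_real k)"
      by (intro Bochner_Integration.integral_cong refl) (simp add: Z_def scaleR_conv_of_real field_simps)
    also have "\<dots> = (of_real (expectation Y) * (CLINT \<omega>|M. iexp (t * X \<omega>)) + of_real (K + 1) * (CLINT \<omega>|M. iexp (t * X \<omega>))) / of_real k"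
      using int_iexp[of t] int_Yiexp[of t] factor[of t] by simp
    also have "\<dots> = of_real k * (CLINT \<omega>|M. iexp (t * X \<omega>)) / of_real k"
      by (simp only: k_def of_real_add distrib_right add.assoc)
    also have "\<dots> = (CLINT \<omega>|M. iexp (t * X \<omega>))" using k by simp
    also have "\<dots> = char (distr M borel X) t"
      unfolding char_def by (subst integral_distr) auto
    finally show "char (distr N borel X) t = char (distr M borel X) t" .
  qed
  then have eq: "distr N borel X = distr M borel X"
    by (intro Levy_uniqueness) (auto intro!: real_distribution_distr N.real_distribution_distr)
  have [measurable]: "B \<in> sets borel" by fact
  have indX: "integrable M (\<lambda>\<omega>. indicator B (X \<omega>) :: real)"
    by (rule integrable_const_bound[of _ 1]) (auto simp: indicator_def)
  have indYX: "integrable M (\<lambda>\<omega>. Y \<omega> * indicator B (X \<omega>))"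
    by (rule integrable_const_bound[of _ K]) (use bound order_trans[OF abs_ge_zero bound] in \<open>auto simp: indicator_def\<close>)
  have "(LINT \<omega>|N. indicator B (X \<omega>)) = (LINT v|distr N borel X. indicator B v :: real)"
    by (subst integral_distr) auto
  also have "\<dots> = expectation (\<lambda>\<omega>. indicator B (X \<omega>))"
    unfolding eq by (subst integral_distr) auto
  finally have *: "expectation (\<lambda>\<omega>. Z \<omega> * indicator B (X \<omega>)) = expectation (\<lambda>\<omega>. indicator B (X \<omega>))"
    by (simp add: Ni)
  have "expectation (\<lambda>\<omega>. Z \<omega> * indicator B (X \<omega>))
      = expectation (\<lambda>\<omega>. (Y \<omega> * indicator B (X \<omega>) + (K + 1) * indicator B (X \<omega>)) / k)"
    by (intro Bochner_Integration.integral_cong refl) (simp add: Z_def field_simps)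
  also have "\<dots> = (expectation (\<lambda>\<omega>. Y \<omega> * indicator B (X \<omega>)) + (K + 1) * expectation (\<lambda>\<omega>. indicator B (X \<omega>))) / k"
    using indX indYX by simp
  finally show ?thesis using k * by (simp add: k_def field_simps)
qed

text \<open>The hypothesis is stable under multiplying \<open>Y\<close> by a constant, and under conjugating \<open>Y\<close>, because \<open>t\<close> may be
  replaced by \<open>-t\<close>. It therefore passes to the real and imaginary parts of \<open>Y\<close>.\<close>

lemma (in prob_space) indicator_factor_of_iexp_factor:
  fixes X :: "'a \<Rightarrow> real" and Y :: "'a \<Rightarrow> complex"
  assumes X [measurable]: "X \<in> borel_measurable M" and Y [measurable]: "Y \<in> borel_measurable M"
    and bound: "\<And>\<omega>. cmod (Y \<omega>) \<le> K"
    and factor: "\<And>t. (CLINT \<omega>|M. Y \<omega> * iexp (t * X \<omega>))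
                   = (CLINT \<omega>|M. Y \<omega>) * (CLINT \<omega>|M. iexp (t * X \<omega>))"
    and B: "B \<in> sets borel"
  shows "(CLINT \<omega>|M. Y \<omega> * indicator B (X \<omega>)) = (CLINT \<omega>|M. Y \<omega>) * (CLINT \<omega>|M. indicator B (X \<omega>))"
proof -
  have [measurable]: "B \<in> sets borel" by fact
  have re_part: "expectation (\<lambda>\<omega>. Re (V \<omega>) * indicator B (X \<omega>))
      = expectation (\<lambda>\<omega>. Re (V \<omega>)) * expectation (\<lambda>\<omega>. indicator B (X \<omega>))"
    if [measurable]: "V \<in> borel_measurable M" and bV: "\<And>\<omega>. cmod (V \<omega>) \<le> K"
      and fV: "\<And>t. (CLINT \<omega>|M. V \<omega> * iexp (t * X \<omega>)) = (CLINT \<omega>|M. V \<omega>) * (CLINT \<omega>|M. iexp (t * X \<omega>))"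
    for V
  proof (rule indicator_factor_of_iexp_factor_real[where K = K])
    fix t
    have i1: "integrable M (\<lambda>\<omega>. V \<omega> * iexp (t * X \<omega>))" for t
      by (rule integrable_const_bound[of _ K]) (use bV in \<open>auto simp: norm_mult\<close>)
    have i0: "integrable M V"
      by (rule integrable_const_bound[of _ K]) (use bV in auto)
    have cnj_V: "(CLINT \<omega>|M. cnj (V \<omega>) * iexp (t * X \<omega>)) = cnj (CLINT \<omega>|M. V \<omega>) * (CLINT \<omega>|M. iexp (t * X \<omega>))"
    proof -
      have "(CLINT \<omega>|M. cnj (V \<omega>) * iexp (t * X \<omega>)) = (CLINT \<omega>|M. cnj (V \<omega> * iexp ((-t) * X \<omega>)))"
        by (simp add: exp_cnj)
      also have "\<dots> = cnj (CLINT \<omega>|M. V \<omega>) * (CLINT \<omega>|M. cnj (iexp ((-t) * X \<omega>)))"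
        using fV[of "-t"] by (simp del: complex_cnj_mult add: integral_cnj) (simp add: integral_cnj)
      finally show ?thesis by (simp add: exp_cnj)
    qed
    have i2: "integrable M (\<lambda>\<omega>. cnj (V \<omega>) * iexp (t * X \<omega>))"
      by (rule integrable_const_bound[of _ K]) (use bV in \<open>auto simp: norm_mult\<close>)
    have "(CLINT \<omega>|M. of_real (Re (V \<omega>)) * iexp (t * X \<omega>))
        = (CLINT \<omega>|M. (V \<omega> * iexp (t * X \<omega>) + cnj (V \<omega>) * iexp (t * X \<omega>)) / 2)"
      by (intro Bochner_Integration.integral_cong refl) (simp add: complex_add_cnj flip: distrib_right)
    also have "\<dots> = ((CLINT \<omega>|M. V \<omega>) + cnj (CLINT \<omega>|M. V \<omega>)) / 2 * (CLINT \<omega>|M. iexp (t * X \<omega>))"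
      using i1[of t] i2 fV[of t] cnj_V by (simp add: algebra_simps add_divide_distrib)
    also have "\<dots> = of_real (expectation (\<lambda>\<omega>. Re (V \<omega>))) * (CLINT \<omega>|M. iexp (t * X \<omega>))"
      using i0 by (simp add: complex_add_cnj)
    finally show "(CLINT \<omega>|M. of_real (Re (V \<omega>)) * iexp (t * X \<omega>))
        = of_real (expectation (\<lambda>\<omega>. Re (V \<omega>))) * (CLINT \<omega>|M. iexp (t * X \<omega>))" .
    show "\<bar>Re (V \<omega>)\<bar> \<le> K" for \<omega> using abs_Re_le_cmod[of "V \<omega>"] bV[of \<omega>] by linarith
  qed (use B in auto)
  have iY: "integrable M Y"
    by (rule integrable_const_bound[of _ K]) (use bound in auto)
  have iYB: "integrable M (\<lambda>\<omega>. Y \<omega> * indicator B (X \<omega>))"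
    by (rule integrable_const_bound[of _ K]) (use bound order_trans[OF norm_ge_zero bound] in \<open>auto simp: indicator_def\<close>)
  have ind: "(CLINT \<omega>|M. indicator B (X \<omega>)) = of_real (expectation (\<lambda>\<omega>. indicator B (X \<omega>)))"
    by (simp flip: integral_complex_of_real add: indicator_def of_bool_def if_distrib cong: if_cong)
  have [simp]: "Re (indicator B u) = indicator B u" "Im (indicator B u) = 0" for u
    by (auto simp: indicator_def)
  have r: "expectation (\<lambda>\<omega>. Re (Y \<omega>) * indicator B (X \<omega>))
      = expectation (\<lambda>\<omega>. Re (Y \<omega>)) * expectation (\<lambda>\<omega>. indicator B (X \<omega>))"
    by (rule re_part) (use bound factor in auto)
  have "expectation (\<lambda>\<omega>. Re (-\<i> * Y \<omega>) * indicator B (X \<omega>))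
      = expectation (\<lambda>\<omega>. Re (-\<i> * Y \<omega>)) * expectation (\<lambda>\<omega>. indicator B (X \<omega>))"
    by (rule re_part) (use bound factor in \<open>auto simp: norm_mult mult.assoc\<close>)
  then have i: "expectation (\<lambda>\<omega>. Im (Y \<omega>) * indicator B (X \<omega>))
      = expectation (\<lambda>\<omega>. Im (Y \<omega>)) * expectation (\<lambda>\<omega>. indicator B (X \<omega>))"
    by simp
  show ?thesis
    unfolding ind using r i iY iYB
    by (intro complex_eqI) (simp_all flip: integral_Re integral_Im)
qed

text \<open>The preceding lemma is applied three times, each time turning the exponential of one variable
  into an indicator while the remaining factors play the role of the bounded weight.\<close>

lemma (in prob_space) prob_box_factor_of_iexp_factor:
  fixes U R I :: "'a \<Rightarrow> real"
  assumes [measurable]: "U \<in> borel_measurable M" "R \<in> borel_measurable M" "I \<in> borel_measurable M"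
    and factor: "\<And>a b c. (CLINT \<omega>|M. iexp (a * U \<omega> + b * R \<omega> + c * I \<omega>))
      = (CLINT \<omega>|M. iexp (a * U \<omega>)) * (CLINT \<omega>|M. iexp (b * R \<omega>)) * (CLINT \<omega>|M. iexp (c * I \<omega>))"
    and sets: "A \<in> sets borel" "B \<in> sets borel" "C \<in> sets borel"
  shows "prob {\<omega> \<in> space M. U \<omega> \<in> A \<and> R \<omega> \<in> B \<and> I \<omega> \<in> C}
    = prob {\<omega> \<in> space M. U \<omega> \<in> A} * prob {\<omega> \<in> space M. R \<omega> \<in> B \<and> I \<omega> \<in> C}"
proof -
  note [measurable] = sets
  define u where "u a = (CLINT \<omega>|M. iexp (a * U \<omega>))" for a
  define r where "r b = (CLINT \<omega>|M. iexp (b * R \<omega>))" for b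
  define i where "i c = (CLINT \<omega>|M. iexp (c * I \<omega>))" for c
  define pB where "pB = (CLINT \<omega>|M. indicator B (R \<omega>))"
  define pC where "pC = (CLINT \<omega>|M. indicator C (I \<omega>))"
  have one: "u 0 = 1" "r 0 = 1" "i 0 = 1" by (auto simp: u_def r_def i_def prob_space)
  have f: "(CLINT \<omega>|M. iexp (a * U \<omega>) * iexp (b * R \<omega>) * iexp (c * I \<omega>)) = u a * r b * i c" for a b c
    using factor[of a b c] by (simp add: u_def r_def i_def exp_add distrib_left mult.assoc)
  have f1: "(CLINT \<omega>|M. iexp (a * U \<omega>) * iexp (c * I \<omega>) * indicator B (R \<omega>)) = u a * i c * pB" for a c
  proof -
    have *: "(CLINT \<omega>|M. iexp (a * U \<omega>) * iexp (c * I \<omega>)) = u a * i c"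
      using f[of a 0 c] by (simp add: one)
    show ?thesis
      unfolding pB_def *[symmetric]
    proof (rule indicator_factor_of_iexp_factor[where K = 1])
      show "(CLINT \<omega>|M. iexp (a * U \<omega>) * iexp (c * I \<omega>) * iexp (t * R \<omega>))
        = (CLINT \<omega>|M. iexp (a * U \<omega>) * iexp (c * I \<omega>)) * (CLINT \<omega>|M. iexp (t * R \<omega>))" for t
        unfolding * r_def[symmetric] using f[of a t c] by (simp add: ac_simps)
    qed (auto simp: norm_mult)
  qed
  have f2: "(CLINT \<omega>|M. iexp (a * U \<omega>) * indicator B (R \<omega>) * indicator C (I \<omega>)) = u a * pB * pC" for a
  proof -
    have *: "(CLINT \<omega>|M. iexp (a * U \<omega>) * indicator B (R \<omega>)) = u a * pB"
      using f1[of a 0] by (simp add: one)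
    show ?thesis
      unfolding pC_def *[symmetric]
    proof (rule indicator_factor_of_iexp_factor[where K = 1])
      show "(CLINT \<omega>|M. iexp (a * U \<omega>) * indicator B (R \<omega>) * iexp (t * I \<omega>))
        = (CLINT \<omega>|M. iexp (a * U \<omega>) * indicator B (R \<omega>)) * (CLINT \<omega>|M. iexp (t * I \<omega>))" for t
        unfolding * i_def[symmetric] using f1[of a t] by (simp add: ac_simps)
    qed (auto simp: norm_mult indicator_def)
  qed
  have f3: "(CLINT \<omega>|M. indicator B (R \<omega>) * indicator C (I \<omega>) * indicator A (U \<omega>))
      = (CLINT \<omega>|M. indicator B (R \<omega>) * indicator C (I \<omega>)) * (CLINT \<omega>|M. indicator A (U \<omega>))"
  proof (rule indicator_factor_of_iexp_factor[where K = 1])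
    have *: "(CLINT \<omega>|M. indicator B (R \<omega>) * indicator C (I \<omega>)) = pB * pC"
      using f2[of 0] by (simp add: one)
    show "(CLINT \<omega>|M. indicator B (R \<omega>) * indicator C (I \<omega>) * iexp (t * U \<omega>))
        = (CLINT \<omega>|M. indicator B (R \<omega>) * indicator C (I \<omega>)) * (CLINT \<omega>|M. iexp (t * U \<omega>))" for t
      unfolding * u_def[symmetric] using f2[of t] by (simp add: ac_simps)
  qed (auto simp: norm_mult indicator_def)
  have ev: "(CLINT \<omega>|M. indicator {\<omega> \<in> space M. P \<omega>} \<omega>) = of_real (prob {\<omega> \<in> space M. P \<omega>})" 
    if [measurable]: "Measurable.pred M P" for P
  proof -
    have "(CLINT \<omega>|M. indicator {\<omega> \<in> space M. P \<omega>} \<omega>) = (CLINT \<omega>|M. of_real (indicator {\<omega> \<in> space M. P \<omega>} \<omega>))"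
      by (intro Bochner_Integration.integral_cong) (auto simp: indicator_def)
    then show ?thesis by (simp add: integral_complex_of_real)
  qed
  have "of_real (prob {\<omega> \<in> space M. U \<omega> \<in> A \<and> R \<omega> \<in> B \<and> I \<omega> \<in> C})
      = (CLINT \<omega>|M. indicator B (R \<omega>) * indicator C (I \<omega>) * indicator A (U \<omega>))"
    by (subst ev[symmetric], simp) (intro Bochner_Integration.integral_cong, auto simp: indicator_def)
  moreover have "of_real (prob {\<omega> \<in> space M. R \<omega> \<in> B \<and> I \<omega> \<in> C})
      = (CLINT \<omega>|M. indicator B (R \<omega>) * indicator C (I \<omega>))"
    by (subst ev[symmetric], simp) (intro Bochner_Integration.integral_cong, auto simp: indicator_def)
  moreover have "of_real (prob {\<omega> \<in> space M. U \<omega> \<in> A}) = (CLINT \<omega>|M. indicator A (U \<omega>))"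
    by (subst ev[symmetric], simp) (intro Bochner_Integration.integral_cong, auto simp: indicator_def)
  ultimately have "complex_of_real (prob {\<omega> \<in> space M. U \<omega> \<in> A \<and> R \<omega> \<in> B \<and> I \<omega> \<in> C})
      = of_real (prob {\<omega> \<in> space M. U \<omega> \<in> A} * prob {\<omega> \<in> space M. R \<omega> \<in> B \<and> I \<omega> \<in> C})"
    using f3 by simp
  then show ?thesis by (simp only: of_real_eq_iff)
qed

section \<open>Uncorrelated Gaussian variables are independent\<close>

text \<open>A point mass obeys the same formula, with variance \<open>0\<close>, so singular covariance matrices are covered.\<close>

lemma (in prob_space) gaussian_real_square_and_iexp:
  assumes "gaussian_real M X"
  shows "integrable M (\<lambda>\<omega>. (X \<omega>)\<^sup>2)"
    and "(CLINT \<omega>|M. iexp (X \<omega>)) = iexp (expectation X) * exp (- of_real (variance X) / 2)"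
proof -
  have [measurable]: "X \<in> borel_measurable M" using assms by (simp add: gaussian_real_def)
  consider \<mu> \<sigma> where "\<sigma> > 0" "distributed M lborel X (normal_density \<mu> \<sigma>)"
    | \<mu> where "AE \<omega> in M. X \<omega> = \<mu>"
    using assms by (auto simp: gaussian_real_def)
  then have "integrable M (\<lambda>\<omega>. (X \<omega>)\<^sup>2) \<and>
    (CLINT \<omega>|M. iexp (X \<omega>)) = iexp (expectation X) * exp (- of_real (variance X) / 2)"
  proof cases
    case 1
    define S where "S \<omega> = (X \<omega> - \<mu>) / \<sigma>" for \<omega>
    have S: "distributed M lborel S std_normal_density"
      using 1 unfolding S_def by (subst (asm) normal_standard_normal_convert) auto
    have X: "X \<omega> = \<mu> + \<sigma> * S \<omega>" for \<omega> using 1(1) by (simp add: S_def)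
    have [measurable]: "S \<in> borel_measurable M" unfolding S_def by simp
    have S1: "integrable M S"
      using distributed_integrable[OF S, of "\<lambda>x. x"] integrable_std_normal_moment[of 1] by simp
    have S2: "integrable M (\<lambda>\<omega>. (S \<omega>)\<^sup>2)"
      using distributed_integrable[OF S, of "\<lambda>x. x\<^sup>2"] integrable_std_normal_moment[of 2] by simp
    have "integrable M (\<lambda>\<omega>. \<mu>\<^sup>2 + 2 * \<mu> * \<sigma> * S \<omega> + \<sigma>\<^sup>2 * (S \<omega>)\<^sup>2)"
      using S1 S2 by simp
    then have sq: "integrable M (\<lambda>\<omega>. (X \<omega>)\<^sup>2)"
      by (simp add: X power2_eq_square algebra_simps)
    have "distr M borel S = std_normal_distribution"
      using distributed_distr_eq_density[OF S] by (simp cong: distr_cong)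
    then have "char (distr M borel S) = (\<lambda>t. complex_of_real (exp (- (t\<^sup>2) / 2)))"
      by (simp add: char_std_normal_distribution)
    moreover have "char (distr M borel S) \<sigma> = (CLINT \<omega>|M. iexp (\<sigma> * S \<omega>))"
      unfolding char_def by (subst integral_distr) auto
    ultimately have *: "(CLINT \<omega>|M. iexp (\<sigma> * S \<omega>)) = of_real (exp (- (\<sigma>\<^sup>2) / 2))" by metis
    have "(CLINT \<omega>|M. iexp (X \<omega>)) = (CLINT \<omega>|M. iexp \<mu> * iexp (\<sigma> * S \<omega>))"
      by (simp add: X exp_add distrib_left)
    also have "\<dots> = iexp \<mu> * (CLINT \<omega>|M. iexp (\<sigma> * S \<omega>))" by simp
    also have "\<dots> = iexp \<mu> * exp (- of_real (\<sigma>\<^sup>2) / 2)"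
      unfolding * by (simp flip: exp_of_real)
    finally show ?thesis
      using sq normal_distributed_expectation[OF 1] normal_distributed_variance[OF 1] by simp
  next
    case 2
    have E: "expectation X = \<mu>"
      using integral_cong_AE[of X M "\<lambda>_. \<mu>"] 2 by (simp add: prob_space)
    have "variance X = expectation (\<lambda>_. 0)"
      by (rule integral_cong_AE) (use 2 E in auto)
    moreover have "(CLINT \<omega>|M. iexp (X \<omega>)) = (CLINT \<omega>|M. iexp \<mu>)"
      by (rule integral_cong_AE) (use 2 in auto)
    moreover have "integrable M (\<lambda>\<omega>. (X \<omega>)\<^sup>2) \<longleftrightarrow> integrable M (\<lambda>\<omega>. \<mu>\<^sup>2)"
      by (rule integrable_cong_AE) (use 2 in auto)
    ultimately show ?thesis using E by (simp add: prob_space)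
  qed
  then show "integrable M (\<lambda>\<omega>. (X \<omega>)\<^sup>2)"
    and "(CLINT \<omega>|M. iexp (X \<omega>)) = iexp (expectation X) * exp (- of_real (variance X) / 2)"
    by auto
qed

text \<open>The characteristic function of a Gaussian depends on mean and variance only, and the variance of
  a combination of uncorrelated variables is additive.\<close>

lemma (in prob_space) uncorrelated_gaussian_iexp_factor:
  fixes U R I :: "'a \<Rightarrow> real"
  assumes gauss: "\<And>a b c. gaussian_real M (\<lambda>\<omega>. a * U \<omega> + b * R \<omega> + c * I \<omega>)"
    and UR: "expectation (\<lambda>\<omega>. (U \<omega> - expectation U) * (R \<omega> - expectation R)) = 0"
    and UI: "expectation (\<lambda>\<omega>. (U \<omega> - expectation U) * (I \<omega> - expectation I)) = 0"
    and RI: "expectation (\<lambda>\<omega>. (R \<omega> - expectation R) * (I \<omega> - expectation I)) = 0"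
  shows "(CLINT \<omega>|M. iexp (a * U \<omega> + b * R \<omega> + c * I \<omega>))
    = (CLINT \<omega>|M. iexp (a * U \<omega>)) * (CLINT \<omega>|M. iexp (b * R \<omega>)) * (CLINT \<omega>|M. iexp (c * I \<omega>))"
proof -
  have gU: "gaussian_real M U" and gR: "gaussian_real M R" and gI: "gaussian_real M I"
    using gauss[of 1 0 0] gauss[of 0 1 0] gauss[of 0 0 1] by simp_all
  have [measurable]: "U \<in> borel_measurable M" "R \<in> borel_measurable M" "I \<in> borel_measurable M"
    using gU gR gI by (simp_all add: gaussian_real_def)
  note sq = gU[THEN gaussian_real_square_and_iexp(1)] gR[THEN gaussian_real_square_and_iexp(1)] gI[THEN gaussian_real_square_and_iexp(1)]
  have int: "integrable M U" "integrable M R" "integrable M I"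
    using sq by (auto intro: square_integrable_imp_integrable)
  define u where "u \<omega> = U \<omega> - expectation U" for \<omega>
  define r where "r \<omega> = R \<omega> - expectation R" for \<omega>
  define i where "i \<omega> = I \<omega> - expectation I" for \<omega>
  have [measurable]: "u \<in> borel_measurable M" "r \<in> borel_measurable M" "i \<in> borel_measurable M"
    unfolding u_def r_def i_def by simp_all
  have sq': "integrable M (\<lambda>\<omega>. (u \<omega>)\<^sup>2)" "integrable M (\<lambda>\<omega>. (r \<omega>)\<^sup>2)" "integrable M (\<lambda>\<omega>. (i \<omega>)\<^sup>2)"
    unfolding u_def r_def i_def power2_diff using sq int by auto
  have cross: "integrable M (\<lambda>\<omega>. u \<omega> * r \<omega>)" "integrable M (\<lambda>\<omega>. u \<omega> * i \<omega>)" "integrable M (\<lambda>\<omega>. r \<omega> * i \<omega>)"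
    using sq' by (auto intro!: square_integrable_bounded_bilinear[OF bounded_bilinear_mult] simp: square_integrable_def)
  have var: "variance (\<lambda>\<omega>. a * U \<omega> + b * R \<omega> + c * I \<omega>)
      = a\<^sup>2 * variance U + b\<^sup>2 * variance R + c\<^sup>2 * variance I" for a b c
  proof -
    have "variance (\<lambda>\<omega>. a * U \<omega> + b * R \<omega> + c * I \<omega>) = expectation (\<lambda>\<omega>. (a * u \<omega> + b * r \<omega> + c * i \<omega>)\<^sup>2)"
      using int by (simp add: u_def r_def i_def algebra_simps)
    also have "\<dots> = expectation (\<lambda>\<omega>. a\<^sup>2 * (u \<omega>)\<^sup>2 + b\<^sup>2 * (r \<omega>)\<^sup>2 + c\<^sup>2 * (i \<omega>)\<^sup>2
        + 2 * a * b * (u \<omega> * r \<omega>) + 2 * a * c * (u \<omega> * i \<omega>) + 2 * b * c * (r \<omega> * i \<omega>))"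
      by (intro Bochner_Integration.integral_cong refl) (simp add: power2_eq_square algebra_simps)
    also have "\<dots> = a\<^sup>2 * expectation (\<lambda>\<omega>. (u \<omega>)\<^sup>2) + b\<^sup>2 * expectation (\<lambda>\<omega>. (r \<omega>)\<^sup>2) + c\<^sup>2 * expectation (\<lambda>\<omega>. (i \<omega>)\<^sup>2)"
      using sq' cross UR UI RI unfolding u_def[symmetric] r_def[symmetric] i_def[symmetric] by simp
    finally show ?thesis by (simp add: u_def r_def i_def)
  qed
  have char: "(CLINT \<omega>|M. iexp (a * U \<omega> + b * R \<omega> + c * I \<omega>))
    = iexp (a * expectation U + b * expectation R + c * expectation I)
      * exp (- of_real (a\<^sup>2 * variance U + b\<^sup>2 * variance R + c\<^sup>2 * variance I) / 2)" for a b c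
    unfolding gaussian_real_square_and_iexp(2)[OF gauss] var using int by simp
  have "(CLINT \<omega>|M. iexp (a * U \<omega>)) = iexp (a * expectation U) * exp (- of_real (a\<^sup>2 * variance U) / 2)"
    "(CLINT \<omega>|M. iexp (b * R \<omega>)) = iexp (b * expectation R) * exp (- of_real (b\<^sup>2 * variance R) / 2)"
    "(CLINT \<omega>|M. iexp (c * I \<omega>)) = iexp (c * expectation I) * exp (- of_real (c\<^sup>2 * variance I) / 2)"
    using char[of a 0 0] char[of 0 b 0] char[of 0 0 c] by simp_all
  then show ?thesis
    unfolding char by (simp add: exp_add[symmetric] algebra_simps add_divide_distrib diff_divide_distrib)
qed

lemma complex_borel_eq_Re_Im_boxes:
  "sets (borel :: complex measure)
     = sigma_sets UNIV {Re -` B \<inter> Im -` C | B C. B \<in> sets borel \<and> C \<in> sets borel}"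
proof
  let ?G = "{Re -` B \<inter> Im -` C | B C. B \<in> sets borel \<and> C \<in> sets borel}"
  show "sigma_sets UNIV ?G \<subseteq> sets borel"
  proof (rule sets.sigma_sets_subset[of _ borel, simplified])
    have "Re -` B \<inter> Im -` C \<in> sets borel" if "B \<in> sets borel" "C \<in> sets borel" for B C
      using measurable_sets[OF borel_measurable_Re that(1)] measurable_sets[OF borel_measurable_Im that(2)] by auto
    then show "?G \<subseteq> sets borel" by auto
  qed
  have "box a b \<in> sigma_sets UNIV ?G" for a b :: complex
  proof -
    have "box a b = Re -` {Re a<..<Re b} \<inter> Im -` {Im a<..<Im b}"
      by (auto simp: box_def Basis_complex_def)
    then show ?thesis by (intro sigma_sets.Basic) (auto intro!: exI)
  qed
  then show "sets (borel :: complex measure) \<subseteq> sigma_sets UNIV ?G"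
    unfolding borel_eq_box by (subst sets_measure_of) (auto intro!: sigma_sets_mono)
qed

text \<open>Boxes form an intersection-stable generator of the Borel sets of the complex plane, so independence
  on boxes suffices. The real variable \<open>U\<close> is embedded into the complex numbers because \<^const>\<open>prob_space.indep_var\<close>
  relates random variables with values in one type.\<close>

lemma (in prob_space) uncorrelated_gaussian_indep_var:
  fixes U :: "'a \<Rightarrow> real" and X :: "'a \<Rightarrow> complex"
  assumes gauss: "\<And>a b c. gaussian_real M (\<lambda>\<omega>. a * U \<omega> + b * Re (X \<omega>) + c * Im (X \<omega>))"
    and UR: "expectation (\<lambda>\<omega>. (U \<omega> - expectation U) * (Re (X \<omega>) - expectation (\<lambda>\<omega>. Re (X \<omega>)))) = 0"
    and UI: "expectation (\<lambda>\<omega>. (U \<omega> - expectation U) * (Im (X \<omega>) - expectation (\<lambda>\<omega>. Im (X \<omega>)))) = 0"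
    and RI: "expectation (\<lambda>\<omega>. (Re (X \<omega>) - expectation (\<lambda>\<omega>. Re (X \<omega>))) * (Im (X \<omega>) - expectation (\<lambda>\<omega>. Im (X \<omega>)))) = 0"
  shows "indep_var borel (\<lambda>\<omega>. complex_of_real (U \<omega>)) borel X"
proof -
  have m: "U \<in> borel_measurable M" "(\<lambda>\<omega>. Re (X \<omega>)) \<in> borel_measurable M" "(\<lambda>\<omega>. Im (X \<omega>)) \<in> borel_measurable M"
    using gauss[of 1 0 0] gauss[of 0 1 0] gauss[of 0 0 1] by (simp_all add: gaussian_real_def)
  have [measurable]: "X \<in> borel_measurable M"
    using m by (simp add: borel_measurable_complex_iff)
  note [measurable] = m
  let ?A = "{(\<lambda>\<omega>. complex_of_real (U \<omega>)) -` A \<inter> space M | A. A \<in> sets borel}"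
  let ?G = "{Re -` B \<inter> Im -` C | B C. B \<in> sets borel \<and> C \<in> sets borel}"
  let ?B = "{X -` G \<inter> space M | G. G \<in> ?G}"
  have indep: "indep_set ?A ?B"
  proof (rule indep_setI)
    show "?A \<subseteq> events" by auto
    show "?B \<subseteq> events"
    proof safe
      fix B C :: "real set" assume "B \<in> sets borel" "C \<in> sets borel"
      then have "Re -` B \<inter> Im -` C \<in> sets borel"
        unfolding complex_borel_eq_Re_Im_boxes by (intro sigma_sets.Basic) blast
      then show "X -` (Re -` B \<inter> Im -` C) \<inter> space M \<in> events" by (rule measurable_sets[rotated]) simp
    qed
    fix a b assume "a \<in> ?A" "b \<in> ?B"
    then obtain A' B C where A': "A' \<in> sets borel" and BC: "B \<in> sets borel" "C \<in> sets borel"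
      and ab: "a = (\<lambda>\<omega>. complex_of_real (U \<omega>)) -` A' \<inter> space M" "b = X -` (Re -` B \<inter> Im -` C) \<inter> space M" by auto
    define A where "A = complex_of_real -` A'"
    have sets: "A \<in> sets borel" "B \<in> sets borel" "C \<in> sets borel"
      using measurable_sets[of complex_of_real borel borel A'] A' BC by (simp_all add: A_def)
    have eq: "a = {\<omega> \<in> space M. U \<omega> \<in> A}" "b = {\<omega> \<in> space M. Re (X \<omega>) \<in> B \<and> Im (X \<omega>) \<in> C}"
      "a \<inter> b = {\<omega> \<in> space M. U \<omega> \<in> A \<and> Re (X \<omega>) \<in> B \<and> Im (X \<omega>) \<in> C}"
      by (auto simp: ab A_def)
    show "prob (a \<inter> b) = prob a * prob b"
      unfolding eq(3) unfolding eq(1,2)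
      by (rule prob_box_factor_of_iexp_factor[OF m _ sets])
         (rule uncorrelated_gaussian_iexp_factor[OF gauss UR UI RI])
  qed
  have "Int_stable ?G"
  proof (rule Int_stableI)
    fix a b assume "a \<in> ?G" "b \<in> ?G"
    then obtain B C B' C' where "a = Re -` B \<inter> Im -` C" "b = Re -` B' \<inter> Im -` C'"
      and "B \<in> sets borel" "C \<in> sets borel" "B' \<in> sets borel" "C' \<in> sets borel" by auto
    then show "a \<inter> b \<in> ?G"
      by (intro CollectI exI[of _ "B \<inter> B'"] exI[of _ "C \<inter> C'"]) auto
  qed
  have stable_vimage: "Int_stable {V -` G \<inter> space M | G. G \<in> \<G>}"
    if "Int_stable \<G>" for V :: "'a \<Rightarrow> complex" and \<G>
  proof (rule Int_stableI)
    fix a b assume "a \<in> {V -` G \<inter> space M | G. G \<in> \<G>}" "b \<in> {V -` G \<inter> space M | G. G \<in> \<G>}"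
    then obtain G H where "G \<in> \<G>" "H \<in> \<G>" "a \<inter> b = V -` (G \<inter> H) \<inter> space M" by auto
    moreover from this have "G \<inter> H \<in> \<G>" using that by (simp add: Int_stable_def)
    ultimately show "a \<inter> b \<in> {V -` G \<inter> space M | G. G \<in> \<G>}"
      by (metis (mono_tags, lifting) mem_Collect_eq)
  qed
  have stable: "Int_stable ?A" "Int_stable ?B"
    by (rule stable_vimage[OF sets.Int_stable], rule stable_vimage[OF \<open>Int_stable ?G\<close>])
  have gen: "sigma_sets (space M) {X -` A \<inter> space M | A. A \<in> sets borel} = sigma_sets (space M) ?B"
  proof -
    have "{X -` A \<inter> space M | A. A \<in> sets borel} = sigma_sets (space M) ?B"
      using sigma_sets_vimage_commute[of X "space M" UNIV ?G]
      unfolding complex_borel_eq_Re_Im_boxes by simp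
    moreover have "?B \<subseteq> Pow (space M)" by blast
    ultimately show ?thesis using sigma_sets_sigma_sets_eq[of ?B "space M"] by simp
  qed
  show ?thesis
    unfolding indep_var_eq gen using indep_set_sigma_sets[OF indep stable] by simp
qed

section \<open>Conditional expectation of proper Gaussian variables\<close>

lemma (in prob_space) gaussian_real_shift:
  assumes "gaussian_real M X"
  shows "gaussian_real M (\<lambda>\<omega>. X \<omega> + c)"
proof -
  have "distributed M lborel (\<lambda>\<omega>. X \<omega> + c) (normal_density (c + 1 * \<mu>) (\<bar>1\<bar> * \<sigma>))"
    if "\<sigma> > 0" "distributed M lborel X (normal_density \<mu> \<sigma>)" for \<mu> \<sigma>
    using normal_density_affine[OF that(2,1), of 1 c] by (simp add: add.commute)
  moreover have "AE \<omega> in M. X \<omega> + c = \<mu> + c" if "AE \<omega> in M. X \<omega> = \<mu>" for \<mu>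
    using that by auto
  ultimately show ?thesis
    using assms unfolding gaussian_real_def by auto
qed

text \<open>A summand that is measurable for the conditioning algebra is kept, an independent one is replaced by its
  mean.\<close>

lemma (in prob_space) real_cond_exp_measurable_plus_indep:
  fixes X :: "'a \<Rightarrow> complex" and P U :: "'a \<Rightarrow> real"
  defines "F \<equiv> vimage_algebra (space M) X borel"
  assumes indep: "indep_var borel (\<lambda>\<omega>. complex_of_real (U \<omega>)) borel X" and U: "integrable M U"
    and P: "integrable M P" and PF: "P \<in> borel_measurable F"
  shows "AE \<omega> in M. real_cond_exp M F (\<lambda>\<omega>. P \<omega> + U \<omega>) \<omega> = P \<omega> + expectation U"
proof -
  have [measurable]: "U \<in> borel_measurable M" "X \<in> borel_measurable M"
    using U indep by (auto simp: indep_var_eq)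
  have sets_F: "sets F = {X -` B \<inter> space M | B. B \<in> sets borel}"
    unfolding F_def by (rule sets_vimage_algebra2) simp
  have space_F: "space F = space M" by (simp add: F_def)
  interpret finite_measure_subalgebra M F
    by unfold_locales (auto simp: subalgebra_def space_F sets_F)
  show ?thesis
  proof (rule real_cond_exp_charact)
    fix A assume "A \<in> sets F"
    then obtain B where [measurable]: "B \<in> sets borel" and A: "A = X -` B \<inter> space M"
      unfolding sets_F by auto
    have [measurable]: "A \<in> events" unfolding A by measurable
    have "indep_var borel (Re \<circ> (\<lambda>\<omega>. complex_of_real (U \<omega>))) borel ((indicator B :: complex \<Rightarrow> real) \<circ> X)"
      by (rule indep_var_compose[OF indep]) auto
    then have indep_B: "indep_var borel U borel (\<lambda>\<omega>. indicator B (X \<omega>))"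
      by (simp add: comp_def)
    have "integrable M (\<lambda>\<omega>. indicator B (X \<omega>) :: real)"
      by (rule integrable_const_bound[of _ 1]) (auto simp: indicator_def)
    from indep_var_lebesgue_integral[OF indep_B U this]
    have "expectation (\<lambda>\<omega>. U \<omega> * indicator B (X \<omega>)) = expectation U * expectation (\<lambda>\<omega>. indicator B (X \<omega>))" .
    moreover have "expectation (\<lambda>\<omega>. indicator A \<omega> * U \<omega>) = expectation (\<lambda>\<omega>. U \<omega> * indicator B (X \<omega>))"
      by (rule Bochner_Integration.integral_cong) (auto simp: A indicator_def)
    moreover have "expectation (indicator A) = expectation (\<lambda>\<omega>. indicator B (X \<omega>))"
      by (rule Bochner_Integration.integral_cong) (auto simp: A indicator_def)
    moreover have "expectation (indicator A) = prob A" by simp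
    ultimately have *: "expectation (\<lambda>\<omega>. indicator A \<omega> * U \<omega>) = expectation U * prob A"
      by metis
    have int_PU: "integrable M (\<lambda>\<omega>. indicator A \<omega> * P \<omega>)" "integrable M (\<lambda>\<omega>. indicator A \<omega> * U \<omega>)"
      using integrable_mult_indicator[OF \<open>A \<in> events\<close> P] integrable_mult_indicator[OF \<open>A \<in> events\<close> U] by simp_all
    have int_A: "integrable M (\<lambda>\<omega>. indicator A \<omega> * expectation U)"
      by (rule integrable_const_bound[of _ "\<bar>expectation U\<bar>"]) (auto simp: indicator_def)
    show "(\<integral>\<omega>\<in>A. (P \<omega> + U \<omega>) \<partial>M) = (\<integral>\<omega>\<in>A. (P \<omega> + expectation U) \<partial>M)"
      using * Bochner_Integration.integral_add[OF int_PU] Bochner_Integration.integral_add[OF int_PU(1) int_A]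
      by (simp add: set_lebesgue_integral_def distrib_left mult.commute[of "prob A"])
  qed (use U P PF in auto)
qed

text \<open>This is linear regression of \<open>Y\<close> on \<open>X\<close>: the vanishing pseudo-covariances \<open>XX\<close> and \<open>XY\<close> make the residual
  \<open>Y - \<alpha> X\<close> independent of \<open>X\<close>, and not just uncorrelated with it in the complex sense. The first of
  them also makes the real and imaginary parts of \<open>X\<close> uncorrelated.\<close>

lemma (in prob_space) cond_exp_given_proper_gaussian:
  fixes X Y :: "'a \<Rightarrow> complex"
  assumes gauss: "\<And>a b. gaussian_real M (\<lambda>\<omega>. Re (a * X \<omega> + b * Y \<omega>))"
    and XX: "expectation (\<lambda>\<omega>. (X \<omega> - expectation X) * (X \<omega> - expectation X)) = 0"
    and XY: "expectation (\<lambda>\<omega>. (X \<omega> - expectation X) * (Y \<omega> - expectation Y)) = 0"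
    and cov: "expectation (\<lambda>\<omega>. (Y \<omega> - expectation Y) * cnj (X \<omega> - expectation X)) = \<alpha> * of_real (variance_c M X)"
  shows "AE \<omega> in M. cond_exp_given M X Y \<omega> = expectation Y + \<alpha> * (X \<omega> - expectation X)"
proof -
  have gparts: "gaussian_real M (\<lambda>\<omega>. Re (X \<omega>))" "gaussian_real M (\<lambda>\<omega>. Im (X \<omega>))"
    "gaussian_real M (\<lambda>\<omega>. Re (Y \<omega>))" "gaussian_real M (\<lambda>\<omega>. Im (Y \<omega>))"
    using gauss[of 1 0] gauss[of "-\<i>" 0] gauss[of 0 1] gauss[of 0 "-\<i>"] by simp_all
  then have [measurable]: "X \<in> borel_measurable M" "Y \<in> borel_measurable M"
    by (simp_all add: borel_measurable_complex_iff gaussian_real_def)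
  have sqX: "square_integrable M X" and sqY: "square_integrable M Y"
    using gparts[THEN gaussian_real_square_and_iexp(1)] by (simp_all add: square_integrable_def cmod_power2)
  note int = square_integrable_integrable
  define W where "W \<omega> = Y \<omega> - \<alpha> * X \<omega>" for \<omega>
  define x where "x \<omega> = X \<omega> - expectation X" for \<omega>
  define y where "y \<omega> = Y \<omega> - expectation Y" for \<omega>
  have sqx: "square_integrable M x" and sqy: "square_integrable M y"
    unfolding x_def y_def using sqX sqY by (auto intro!: square_integrable_diff square_integrable_const)
  have iXY [simp]: "integrable M X" "integrable M Y" "integrable M x" "integrable M y"
    using sqX sqY sqx sqy by (auto intro: int)
  have i2 [simp]: "integrable M (\<lambda>\<omega>. x \<omega> * x \<omega>)" "integrable M (\<lambda>\<omega>. x \<omega> * y \<omega>)"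
    using square_integrable_bounded_bilinear[OF bounded_bilinear_mult] sqx sqy by blast+
  have bb: "bounded_bilinear (\<lambda>a b :: complex. a * cnj b)"
    by (rule bounded_bilinear.comp[OF bounded_bilinear_mult bounded_linear_ident bounded_linear_cnj])
  have i2c [simp]: "integrable M (\<lambda>\<omega>. x \<omega> * cnj (x \<omega>))" "integrable M (\<lambda>\<omega>. y \<omega> * cnj (x \<omega>))"
    using square_integrable_bounded_bilinear[OF bb] sqx sqy by blast+
  have w: "W \<omega> - expectation W = y \<omega> - \<alpha> * x \<omega>" for \<omega>
    by (simp add: W_def[abs_def] x_def y_def algebra_simps)
  have Wx: "expectation (\<lambda>\<omega>. (W \<omega> - expectation W) * x \<omega>) = 0"
  proof -
    have "expectation (\<lambda>\<omega>. (W \<omega> - expectation W) * x \<omega>) = expectation (\<lambda>\<omega>. x \<omega> * y \<omega> - \<alpha> * (x \<omega> * x \<omega>))"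
      by (simp add: w algebra_simps)
    then show ?thesis using XX XY by (simp add: x_def[symmetric] y_def[symmetric])
  qed
  have Wcx: "expectation (\<lambda>\<omega>. (W \<omega> - expectation W) * cnj (x \<omega>)) = 0"
  proof -
    have "expectation (\<lambda>\<omega>. (W \<omega> - expectation W) * cnj (x \<omega>)) = expectation (\<lambda>\<omega>. y \<omega> * cnj (x \<omega>) - \<alpha> * (x \<omega> * cnj (x \<omega>)))"
      by (simp add: w algebra_simps)
    also have "\<dots> = \<alpha> * of_real (variance_c M X) - \<alpha> * expectation (\<lambda>\<omega>. x \<omega> * cnj (x \<omega>))"
      using cov by (simp add: x_def[symmetric] y_def[symmetric])
    also have "expectation (\<lambda>\<omega>. x \<omega> * cnj (x \<omega>)) = expectation (\<lambda>\<omega>. of_real ((cmod (x \<omega>))\<^sup>2))"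
      by (simp only: complex_norm_square)
    also have "\<dots> = of_real (variance_c M X)"
      by (simp only: variance_c_def x_def integral_complex_of_real)
    finally show ?thesis by simp
  qed
  have sqw: "square_integrable M (\<lambda>\<omega>. W \<omega> - expectation W)"
    unfolding w using sqx sqy
    by (auto intro!: square_integrable_diff square_integrable_linear[where f = "(*) \<alpha>"] simp: linear_times)
  have iW [simp]: "integrable M W" unfolding W_def by simp
  have i3 [simp]: "integrable M (\<lambda>\<omega>. (W \<omega> - expectation W) * x \<omega>)" "integrable M (\<lambda>\<omega>. (W \<omega> - expectation W) * cnj (x \<omega>))"
    using square_integrable_bounded_bilinear[OF bounded_bilinear_mult sqw sqx] square_integrable_bounded_bilinear[OF bb sqw sqx] by blast+
  let ?F = "vimage_algebra (space M) X borel"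
  \<comment> \<open>Real and imaginary part are the cases \<open>\<kappa> = 1\<close> and \<open>\<kappa> = -\<i>\<close>. The correlations with the parts of \<open>X\<close> are
    recovered from \<open>2 Re a Re b = Re (a b) + Re (a b\<^sup>*)\<close> and \<open>2 Re a Im b = Im (a b) - Im (a b\<^sup>*)\<close>.\<close>
  have part: "AE \<omega> in M. real_cond_exp M ?F (\<lambda>\<omega>. Re (\<kappa> * Y \<omega>)) \<omega> = Re (\<kappa> * (\<alpha> * X \<omega> + expectation W))" for \<kappa>
  proof -
    let ?U = "\<lambda>\<omega>. Re (\<kappa> * W \<omega>)"
    have EU: "expectation ?U = Re (\<kappa> * expectation W)" by simp
    have EX: "expectation (\<lambda>\<omega>. Re (X \<omega>)) = Re (expectation X)" "expectation (\<lambda>\<omega>. Im (X \<omega>)) = Im (expectation X)"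
      by simp_all
    have "indep_var borel (\<lambda>\<omega>. complex_of_real (?U \<omega>)) borel X"
    proof (rule uncorrelated_gaussian_indep_var)
      fix a b c
      have eq: "(\<lambda>\<omega>. a * Re (\<kappa> * W \<omega>) + b * Re (X \<omega>) + c * Im (X \<omega>))
        = (\<lambda>\<omega>. Re ((Complex b (- c) - of_real a * \<kappa> * \<alpha>) * X \<omega> + (of_real a * \<kappa>) * Y \<omega>))"
        by (simp add: W_def fun_eq_iff algebra_simps)
      show "gaussian_real M (\<lambda>\<omega>. a * Re (\<kappa> * W \<omega>) + b * Re (X \<omega>) + c * Im (X \<omega>))"
        unfolding eq by (rule gauss)
    next
      have "expectation (\<lambda>\<omega>. (?U \<omega> - expectation ?U) * (Re (X \<omega>) - expectation (\<lambda>\<omega>. Re (X \<omega>))))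
        = expectation (\<lambda>\<omega>. Re (\<kappa> * ((W \<omega> - expectation W) * x \<omega>) + \<kappa> * ((W \<omega> - expectation W) * cnj (x \<omega>))) / 2)"
        unfolding EU EX by (intro Bochner_Integration.integral_cong refl) (simp add: x_def algebra_simps)
      also have "\<dots> = Re (expectation (\<lambda>\<omega>. \<kappa> * ((W \<omega> - expectation W) * x \<omega>) + \<kappa> * ((W \<omega> - expectation W) * cnj (x \<omega>)))) / 2"
        by (subst integral_divide_zero, subst integral_Re) (auto simp del: plus_complex.sel)
      also have "\<dots> = 0" by (simp add: Wx Wcx del: plus_complex.sel times_complex.sel)
      finally show "expectation (\<lambda>\<omega>. (?U \<omega> - expectation ?U) * (Re (X \<omega>) - expectation (\<lambda>\<omega>. Re (X \<omega>)))) = 0" .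
    next
      have "expectation (\<lambda>\<omega>. (?U \<omega> - expectation ?U) * (Im (X \<omega>) - expectation (\<lambda>\<omega>. Im (X \<omega>))))
        = expectation (\<lambda>\<omega>. Im (\<kappa> * ((W \<omega> - expectation W) * x \<omega>) - \<kappa> * ((W \<omega> - expectation W) * cnj (x \<omega>))) / 2)"
        unfolding EU EX by (intro Bochner_Integration.integral_cong refl) (simp add: x_def algebra_simps)
      also have "\<dots> = Im (expectation (\<lambda>\<omega>. \<kappa> * ((W \<omega> - expectation W) * x \<omega>) - \<kappa> * ((W \<omega> - expectation W) * cnj (x \<omega>)))) / 2"
        by (subst integral_divide_zero, subst integral_Im) (auto simp del: minus_complex.sel)
      also have "\<dots> = 0" by (simp add: Wx Wcx del: minus_complex.sel times_complex.sel)
      finally show "expectation (\<lambda>\<omega>. (?U \<omega> - expectation ?U) * (Im (X \<omega>) - expectation (\<lambda>\<omega>. Im (X \<omega>)))) = 0" .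
    next
      have "expectation (\<lambda>\<omega>. (Re (X \<omega>) - expectation (\<lambda>\<omega>. Re (X \<omega>))) * (Im (X \<omega>) - expectation (\<lambda>\<omega>. Im (X \<omega>))))
        = expectation (\<lambda>\<omega>. Im (x \<omega> * x \<omega>) / 2)"
        unfolding EX by (intro Bochner_Integration.integral_cong refl) (simp add: x_def algebra_simps)
      also have "\<dots> = Im (expectation (\<lambda>\<omega>. x \<omega> * x \<omega>)) / 2"
        by (subst integral_divide_zero, subst integral_Im) (auto simp del: times_complex.sel)
      also have "\<dots> = 0" using XX by (simp add: x_def[symmetric])
      finally show "expectation (\<lambda>\<omega>. (Re (X \<omega>) - expectation (\<lambda>\<omega>. Re (X \<omega>))) * (Im (X \<omega>) - expectation (\<lambda>\<omega>. Im (X \<omega>)))) = 0" .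
    qed
    moreover have "(\<lambda>\<omega>. Re (\<kappa> * (\<alpha> * X \<omega>))) \<in> borel_measurable ?F"
    proof -
      have [measurable]: "X \<in> borel_measurable ?F" by (rule measurable_vimage_algebra1) simp
      show ?thesis by measurable
    qed
    ultimately have "AE \<omega> in M. real_cond_exp M ?F (\<lambda>\<omega>. Re (\<kappa> * (\<alpha> * X \<omega>)) + ?U \<omega>) \<omega>
        = Re (\<kappa> * (\<alpha> * X \<omega>)) + expectation ?U"
      by (intro real_cond_exp_measurable_plus_indep) (auto simp del: times_complex.sel)
    moreover have "(\<lambda>\<omega>. Re (\<kappa> * (\<alpha> * X \<omega>)) + ?U \<omega>) = (\<lambda>\<omega>. Re (\<kappa> * Y \<omega>))"
      by (simp add: W_def fun_eq_iff algebra_simps)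
    ultimately show ?thesis unfolding EU by (simp add: distrib_left)
  qed
  have EW: "expectation W = expectation Y - \<alpha> * expectation X" by (simp add: W_def[abs_def])
  have "AE \<omega> in M. real_cond_exp M ?F (\<lambda>\<omega>. Re (Y \<omega>)) \<omega> = Re (\<alpha> * X \<omega> + expectation W)"
    using part[of 1] by simp
  moreover have "AE \<omega> in M. real_cond_exp M ?F (\<lambda>\<omega>. Im (Y \<omega>)) \<omega> = Im (\<alpha> * X \<omega> + expectation W)"
    using part[of "-\<i>"] by (simp add: algebra_simps)
  ultimately show ?thesis
  proof eventually_elim
    case (elim \<omega>)
    then have "cond_exp_given M X Y \<omega> = \<alpha> * X \<omega> + expectation W"
      unfolding cond_exp_given_def by (intro complex_eqI) simp_all
    then show ?case by (simp add: EW algebra_simps)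
  qed
qed

section \<open>Algebra of complex covariance matrices\<close>

definition herm :: "complex^'n^'m \<Rightarrow> complex^'m^'n" where
  "herm A = (\<chi> i j. cnj (A $ j $ i))"

lemma herm_nth [simp]: "herm A $ i $ j = cnj (A $ j $ i)"
  by (simp add: herm_def)

lemma herm_herm [simp]: "herm (herm A) = A"
  by (simp add: vec_eq_iff)

lemma herm_mult: "herm (A ** B) = herm B ** herm A"
  by (simp add: vec_eq_iff matrix_matrix_mult_def mult.commute)

lemma herm_add: "herm (A + B) = herm A + herm B" and herm_diff: "herm (A - B) = herm A - herm B"
  by (simp_all add: vec_eq_iff)

lemma herm_mat_1 [simp]: "herm (mat 1) = mat 1"
  by (simp add: vec_eq_iff mat_def)

lemma linear_herm: "linear herm"
  by (rule linearI) (simp_all add: vec_eq_iff)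

lemma matrix_add_rdistrib: "(A + B) ** C = A ** C + B ** (C :: 'a::semiring_1^'n^'m)"
  by (simp add: vec_eq_iff matrix_matrix_mult_def distrib_right sum.distrib)

lemma matrix_diff_rdistrib: "(A - B) ** C = A ** C - B ** (C :: 'a::ring_1^'n^'m)"
  by (simp add: vec_eq_iff matrix_matrix_mult_def left_diff_distrib sum_subtractf)

lemma matrix_diff_ldistrib: "A ** (B - C) = A ** B - A ** (C :: 'a::ring_1^'n^'m)"
  by (simp add: vec_eq_iff matrix_matrix_mult_def right_diff_distrib sum_subtractf)

lemma linear_matrix_vector_complex: "linear ((*v) (A :: complex^'n^'m))"
  by (rule linearI) (simp_all add: vec_eq_iff matrix_vector_mult_def distrib_left sum.distrib scaleR_sum_right)

lemma linear_matrix_mult_left_complex: "linear (\<lambda>X :: complex^'k^'n. (A :: complex^'n^'m) ** X)"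
  by (rule linearI) (simp_all add: vec_eq_iff matrix_matrix_mult_def distrib_left sum.distrib scaleR_sum_right)

lemma matrix_inv_inverse:
  assumes "invertible A"
  shows "A ** matrix_inv A = mat 1" "matrix_inv A ** A = mat 1"
  using someI_ex[OF assms[unfolded invertible_def]] by (simp_all add: matrix_inv_def)

lemma herm_matrix_inv:
  assumes inv: "invertible A" and herm: "herm A = A"
  shows "herm (matrix_inv A) = matrix_inv A"
proof -
  have "herm (matrix_inv A) = herm (matrix_inv A) ** (A ** matrix_inv A)"
    by (simp add: matrix_inv_inverse[OF inv])
  also have "\<dots> = herm (A ** matrix_inv A) ** matrix_inv A"
    by (simp add: herm_mult herm matrix_mul_assoc)
  finally show ?thesis by (simp add: matrix_inv_inverse[OF inv])
qed

lemma bounded_bilinear_outer_H: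
  "bounded_bilinear (outer_H :: complex^'n \<Rightarrow> complex^'m \<Rightarrow> complex^'m^'n)"
proof -
  have "bilinear (outer_H :: complex^'n \<Rightarrow> complex^'m \<Rightarrow> complex^'m^'n)"
    unfolding bilinear_def
    by (intro conjI allI linearI) (simp_all add: vec_eq_iff outer_H_def distrib_left distrib_right)
  then show ?thesis by (simp add: bilinear_conv_bounded_bilinear)
qed

interpretation outer_H: bounded_bilinear outer_H by (rule bounded_bilinear_outer_H)

lemma outer_H_mult_left: "outer_H (A *v u) v = A ** outer_H u v"
  by (simp add: vec_eq_iff outer_H_def matrix_vector_mult_def matrix_matrix_mult_def sum_distrib_right mult.assoc)

lemma herm_outer_H: "herm (outer_H u v) = outer_H v u"
  by (simp add: vec_eq_iff outer_H_def mult.commute)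

lemma integral_linear:
  fixes f :: "'a::euclidean_space \<Rightarrow> 'b::euclidean_space"
  assumes "linear f" "integrable M u"
  shows "(LINT \<omega>|M. f (u \<omega>)) = f (LINT \<omega>|M. u \<omega>)"
  using assms by (intro integral_bounded_linear) (simp_all add: linear_conv_bounded_linear)

lemma integral_vec_nth:
  fixes u :: "'w \<Rightarrow> 'a::euclidean_space^'n"
  assumes "integrable M u"
  shows "(LINT \<omega>|M. u \<omega>) $ i = (LINT \<omega>|M. u \<omega> $ i)"
  by (rule integral_bounded_linear[OF bounded_linear_vec_nth assms, symmetric])

lemma integrable_vec_nth:
  fixes u :: "'w \<Rightarrow> 'a::euclidean_space^'n"
  assumes "integrable M u"
  shows "integrable M (\<lambda>\<omega>. u \<omega> $ i)"
  by (rule integrable_bounded_linear[OF bounded_linear_vec_nth assms])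

context prob_space
begin

lemma mean_affine:
  assumes "integrable M u"
  shows "mean M (\<lambda>\<omega>. A *v u \<omega> + c) = A *v mean M u + c"
  using assms integrable_bounded_linear[of "(*v) A" M u] linear_matrix_vector_complex[of A]
  by (simp add: mean_def integral_linear prob_space linear_conv_bounded_linear)

lemma mean_diff:
  assumes "integrable M u" "integrable M v"
  shows "mean M (\<lambda>\<omega>. u \<omega> - v \<omega>) = mean M u - mean M v"
  using assms by (simp add: mean_def)

lemma integrable_cov:
  assumes "square_integrable M u" "square_integrable M v"
  shows "integrable M (\<lambda>\<omega>. outer_H (u \<omega> - mean M u) (v \<omega> - mean M v))"
  using assms
  by (intro square_integrable_bounded_bilinear[OF bounded_bilinear_outer_H] square_integrable_diff square_integrable_const)

lemma cov_mat_nth: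
  assumes "square_integrable M u" "square_integrable M v"
  shows "cov_mat M u v $ i $ j = (CLINT \<omega>|M. (u \<omega> $ i - mean M u $ i) * cnj (v \<omega> $ j - mean M v $ j))"
  using integrable_cov[OF assms]
  by (simp add: cov_mat_def integral_vec_nth integrable_vec_nth) (simp add: outer_H_def)

lemma herm_cov_mat:
  assumes "square_integrable M u" "square_integrable M v"
  shows "herm (cov_mat M u v) = cov_mat M v u"
  unfolding cov_mat_def integral_linear[OF linear_herm integrable_cov[OF assms], symmetric]
  by (simp add: herm_outer_H)

lemma square_integrable_affine:
  fixes u :: "'a \<Rightarrow> complex^'k"
  assumes "square_integrable M u"
  shows "square_integrable M (\<lambda>\<omega>. A *v u \<omega> + c)"
  using assms by (intro square_integrable_add square_integrable_const square_integrable_linear[OF linear_matrix_vector_complex])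

lemma cov_mat_affine_left:
  assumes u: "square_integrable M u" and v: "square_integrable M v"
  shows "cov_mat M (\<lambda>\<omega>. A *v u \<omega> + c) v = A ** cov_mat M u v"
proof -
  have "A *v u \<omega> + c - mean M (\<lambda>\<omega>. A *v u \<omega> + c) = A *v (u \<omega> - mean M u)" for \<omega>
    unfolding mean_affine[OF square_integrable_integrable[OF u]]
    by (simp add: matrix_vector_mult_diff_distrib)
  then show ?thesis
    using integrable_cov[OF u v]
    by (simp add: cov_mat_def outer_H_mult_left integral_linear[OF linear_matrix_mult_left_complex])
qed

lemma cov_mat_diff_left:
  assumes u: "square_integrable M u" and u': "square_integrable M u'" and v: "square_integrable M v"
  shows "cov_mat M (\<lambda>\<omega>. u \<omega> - u' \<omega>) v = cov_mat M u v - cov_mat M u' v"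
proof -
  have "u \<omega> - u' \<omega> - mean M (\<lambda>\<omega>. u \<omega> - u' \<omega>) = (u \<omega> - mean M u) - (u' \<omega> - mean M u')" for \<omega>
    unfolding mean_diff[OF u[THEN square_integrable_integrable] u'[THEN square_integrable_integrable]]
    by simp
  then show ?thesis
    using integrable_cov[OF u v] integrable_cov[OF u' v]
    unfolding cov_mat_def by (simp only: outer_H.diff_left[of "u _ - mean M u"] Bochner_Integration.integral_diff)
qed

lemma second_moment_eq_cov_plus_mean:
  assumes u: "square_integrable M u"
  shows "(LINT \<omega>|M. outer_H (u \<omega>) (u \<omega>)) = cov_mat M u u + outer_H (mean M u) (mean M u)"
proof -
  note int = square_integrable_bounded_bilinear[OF bounded_bilinear_outer_H]
  have i: "integrable M u" by (rule square_integrable_integrable[OF u])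
  have "cov_mat M u u = (LINT \<omega>|M. outer_H (u \<omega>) (u \<omega>) - outer_H (mean M u) (u \<omega>)
      - outer_H (u \<omega>) (mean M u) + outer_H (mean M u) (mean M u))"
    by (simp add: cov_mat_def outer_H.diff_left outer_H.diff_right algebra_simps)
  also have "\<dots> = (LINT \<omega>|M. outer_H (u \<omega>) (u \<omega>)) - (LINT \<omega>|M. outer_H (mean M u) (u \<omega>))
      - (LINT \<omega>|M. outer_H (u \<omega>) (mean M u)) + outer_H (mean M u) (mean M u)"
    using int[OF u u] int[OF square_integrable_const[of "mean M u"] u] int[OF u square_integrable_const[of "mean M u"]]
    by (simp add: prob_space)
  also have "(LINT \<omega>|M. outer_H (mean M u) (u \<omega>)) = outer_H (mean M u) (mean M u)"
    using integral_bounded_linear[OF outer_H.bounded_linear_right i] by (simp add: mean_def)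
  also have "(LINT \<omega>|M. outer_H (u \<omega>) (mean M u)) = outer_H (mean M u) (mean M u)"
    using integral_bounded_linear[OF outer_H.bounded_linear_left i] by (simp add: mean_def)
  finally show ?thesis by simp
qed

lemma mean_nth: "integrable M u \<Longrightarrow> mean M u $ i = (CLINT \<omega>|M. component u i \<omega>)"
  by (simp add: mean_def integral_vec_nth component_def)

lemma cov_mat_diag:
  assumes u: "square_integrable M u"
  shows "cov_mat M u u $ i $ i = of_real (variance_c M (component u i))"
  using u mean_nth[OF square_integrable_integrable[OF u], of i]
  by (simp only: cov_mat_nth variance_c_def complex_norm_square[symmetric] integral_complex_of_real component_def)

lemma variance_c_nonneg: "variance_c M f \<ge> 0"
  by (simp add: variance_c_def)

text \<open>A component of variance \<open>0\<close> is almost surely constant and so uncorrelated with everything.\<close>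

lemma cov_mat_row_eq_0_if_variance_0:
  assumes u: "square_integrable M u" and v: "square_integrable M v"
    and var: "variance_c M (component u i) = 0"
  shows "cov_mat M u v $ i = 0"
proof -
  have [measurable]: "(\<lambda>\<omega>. u \<omega> $ i) \<in> borel_measurable M" "(\<lambda>\<omega>. v \<omega> $ j) \<in> borel_measurable M" for j
    using u v by (blast intro: borel_measurable_integrable integrable_vec_nth square_integrable_integrable)+
  have "square_integrable M (\<lambda>\<omega>. u \<omega> $ i - mean M u $ i)"
    using u by (intro square_integrable_diff square_integrable_const square_integrable_linear[where f = "\<lambda>z. z $ i"])
      (auto simp: linear_conv_bounded_linear bounded_linear_vec_nth)
  then have "integrable M (\<lambda>\<omega>. (cmod (u \<omega> $ i - mean M u $ i))\<^sup>2)"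
    by (simp add: square_integrable_def)
  moreover have "(LINT \<omega>|M. (cmod (u \<omega> $ i - mean M u $ i))\<^sup>2) = 0"
    using var mean_nth[OF square_integrable_integrable[OF u], of i]
    by (simp add: variance_c_def component_def)
  ultimately have "AE \<omega> in M. (cmod (u \<omega> $ i - mean M u $ i))\<^sup>2 = 0"
    by (subst (asm) integral_nonneg_eq_0_iff_AE) auto
  then have ae: "AE \<omega> in M. u \<omega> $ i - mean M u $ i = 0" by simp
  have "cov_mat M u v $ i $ j = 0" for j
  proof -
    have "(CLINT \<omega>|M. (u \<omega> $ i - mean M u $ i) * cnj (v \<omega> $ j - mean M v $ j)) = 0"
      by (rule integral_eq_zero_AE) (use ae in auto)
    then show ?thesis using u v by (simp add: cov_mat_nth)
  qed
  then show ?thesis by (simp add: vec_eq_iff)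
qed

end

section \<open>The constrained estimation problem\<close>

lemma (in prob_space) gaussian_vec_linear:
  fixes f :: "'b::euclidean_space \<Rightarrow> real"
  assumes Z: "gaussian_vec M Z" and f: "linear f"
  shows "gaussian_real M (\<lambda>\<omega>. f (Z \<omega>))"
proof -
  have "f z = adjoint f 1 \<bullet> z" for z
    using adjoint_works[OF f, of z 1] by (simp add: inner_commute)
  then show ?thesis using Z by (simp add: gaussian_vec_def)
qed

lemma (in prob_space) gaussian_vec_square_integrable:
  assumes Z: "gaussian_vec M Z"
  shows "square_integrable M Z"
proof -
  have "integrable M (\<lambda>\<omega>. \<Sum>b\<in>Basis. (b \<bullet> Z \<omega>)\<^sup>2)"
    using Z by (intro Bochner_Integration.integrable_sum gaussian_real_square_and_iexp(1)) (simp add: gaussian_vec_def)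
  moreover have "(norm z)\<^sup>2 = (\<Sum>b\<in>Basis. (b \<bullet> z)\<^sup>2)" for z :: 'b
    unfolding power2_norm_eq_inner by (subst euclidean_inner) (simp add: power2_eq_square inner_commute)
  ultimately show ?thesis using Z by (simp add: square_integrable_def gaussian_vec_def)
qed

locale proper_gaussian_model = prob_space M for M :: "'w measure" +
  fixes x :: "'w \<Rightarrow> complex^'n" and y :: "'w \<Rightarrow> complex^'m"
  assumes joint: "jointly_proper_gaussian M x y"
    and inv_Cyy: "invertible (cov_mat M y y)"
    and var_pos: "\<And>i. variance_c M (component x i) > 0"
    and cross_nonzero: "\<And>i. cov_mat M y (comp_vec x i) \<noteq> 0"
begin

abbreviation "Cxx \<equiv> cov_mat M x x"
abbreviation "Cxy \<equiv> cov_mat M x y"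
abbreviation "Cyx \<equiv> cov_mat M y x"
abbreviation "Cyy \<equiv> cov_mat M y y"

lemma gaussian_stack: "gaussian_vec M (\<lambda>\<omega>. stack (x \<omega>) (y \<omega>))"
  and pseudo_stack: "pseudo_cov_mat M (\<lambda>\<omega>. stack (x \<omega>) (y \<omega>)) = 0"
  using joint by (simp_all add: jointly_proper_gaussian_def proper_gaussian_def)

lemma sq_stack: "square_integrable M (\<lambda>\<omega>. stack (x \<omega>) (y \<omega>))"
  by (rule gaussian_vec_square_integrable[OF gaussian_stack])

lemma sq_x: "square_integrable M x" and sq_y: "square_integrable M y"
proof -
  have "linear (\<lambda>z :: complex^('n + 'm). \<chi> i. z $ Inl i)" "linear (\<lambda>z :: complex^('n + 'm). \<chi> j. z $ Inr j)"
    by (auto intro!: linearI simp: vec_eq_iff)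
  from this[THEN square_integrable_linear, OF sq_stack] show "square_integrable M x" "square_integrable M y"
    by (simp_all add: stack_def)
qed

lemma integrable_x: "integrable M x" and integrable_y: "integrable M y"
  using sq_x sq_y by (auto intro: square_integrable_integrable)

lemma pseudo_x_x: "(CLINT \<omega>|M. (x \<omega> $ i - mean M x $ i) * (x \<omega> $ i - mean M x $ i)) = 0" (is ?xx)
  and pseudo_x_y: "(CLINT \<omega>|M. (x \<omega> $ i - mean M x $ i) * (y \<omega> $ j - mean M y $ j)) = 0" (is ?xy)
proof -
  let ?Z = "\<lambda>\<omega>. stack (x \<omega>) (y \<omega>)"
  have "mean M ?Z $ k = stack (mean M x) (mean M y) $ k" for k
    unfolding mean_nth[OF square_integrable_integrable[OF sq_stack]]
    by (cases k) (simp_all add: stack_def component_def mean_nth[OF integrable_x] mean_nth[OF integrable_y])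
  then have mean: "mean M ?Z = stack (mean M x) (mean M y)"
    by (simp add: vec_eq_iff)
  have diff: "?Z \<omega> - mean M ?Z = stack (x \<omega> - mean M x) (y \<omega> - mean M y)" for \<omega>
    unfolding mean by (auto simp: vec_eq_iff stack_def split: sum.split)
  have bb: "bounded_bilinear (outer_T :: complex^('n + 'm) \<Rightarrow> complex^('n + 'm) \<Rightarrow> _)"
  proof -
    have "bilinear (outer_T :: complex^('n + 'm) \<Rightarrow> complex^('n + 'm) \<Rightarrow> _)"
      unfolding bilinear_def
      by (intro conjI allI linearI) (simp_all add: vec_eq_iff outer_T_def distrib_left distrib_right)
    then show ?thesis by (simp add: bilinear_conv_bounded_bilinear)
  qed
  have "integrable M (\<lambda>\<omega>. outer_T (?Z \<omega> - mean M ?Z) (?Z \<omega> - mean M ?Z))"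
    by (intro square_integrable_bounded_bilinear[OF bb] square_integrable_diff sq_stack square_integrable_const)
  then have "pseudo_cov_mat M ?Z $ k $ l = (CLINT \<omega>|M. outer_T (?Z \<omega> - mean M ?Z) (?Z \<omega> - mean M ?Z) $ k $ l)" for k l
    by (simp add: pseudo_cov_mat_def integral_vec_nth integrable_vec_nth)
  then have "(CLINT \<omega>|M. outer_T (?Z \<omega> - mean M ?Z) (?Z \<omega> - mean M ?Z) $ k $ l) = 0" for k l
    by (simp add: pseudo_stack)
  from this[of "Inl i" "Inl i"] this[of "Inl i" "Inr j"] show ?xx ?xy
    by (simp_all add: outer_T_def diff) (simp_all add: stack_def)
qed

lemma herm_Cyy: "herm Cyy = Cyy" and herm_Cxy: "herm Cxy = Cyx" and herm_Cyx: "herm Cyx = Cxy"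
  using sq_x sq_y by (simp_all add: herm_cov_mat)

lemma cov_nth_comp_vec: "cov_mat M y (comp_vec x i) $ j $ 1 = Cyx $ j $ i"
  "cov_mat M (comp_vec x i) y $ 1 $ j = Cxy $ i $ j"
proof -
  have lin: "linear (\<lambda>z :: complex^'n. vec (z $ i) :: complex^1)"
    by (auto intro!: linearI simp: vec_eq_iff)
  have sq: "square_integrable M (comp_vec x i)"
    unfolding comp_vec_def by (rule square_integrable_linear[OF lin sq_x])
  have mean: "mean M (comp_vec x i) = vec (mean M x $ i)"
    unfolding mean_def comp_vec_def using integral_linear[OF lin integrable_x] by simp
  show "cov_mat M y (comp_vec x i) $ j $ 1 = Cyx $ j $ i" "cov_mat M (comp_vec x i) y $ 1 $ j = Cxy $ i $ j"
    using sq sq_x sq_y by (simp_all add: cov_mat_nth mean) (simp_all add: comp_vec_def)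
qed

text \<open>The gain matrix of the LMMSE estimator without the unbiasedness constraint; \<open>E_CL\<close> rescales its rows.\<close>

abbreviation "lmmse_gain \<equiv> Cxy ** matrix_inv Cyy"

lemma lmmse_gain_Cyy: "lmmse_gain ** Cyy = Cxy"
  by (simp add: matrix_inv_inverse[OF inv_Cyy] flip: matrix_mul_assoc)

lemma herm_lmmse_gain: "herm lmmse_gain = matrix_inv Cyy ** Cyx"
  by (simp add: herm_mult herm_matrix_inv[OF inv_Cyy herm_Cyy] herm_Cxy)

lemma A_eq: "A_CL M x y = lmmse_gain ** Cyx" "A_CL M x y = Cxy ** herm lmmse_gain" "A_CL M x y = lmmse_gain ** Cyy ** herm lmmse_gain"
  by (simp_all add: A_CL_def herm_lmmse_gain lmmse_gain_Cyy) (simp_all add: matrix_mul_assoc)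

lemma quadratic_form_variance:
  "(G ** Cyy ** herm G) $ i $ i = of_real (variance_c M (component (\<lambda>\<omega>. G *v y \<omega>) i))"
proof -
  let ?u = "\<lambda>\<omega>. G *v y \<omega>"
  have sq: "square_integrable M ?u"
    by (rule square_integrable_linear[OF linear_matrix_vector_complex sq_y])
  have left: "cov_mat M ?u v = G ** cov_mat M y v" if "square_integrable M v" for v :: "'w \<Rightarrow> complex^'k"
    using cov_mat_affine_left[OF sq_y that, of G 0] by simp
  have "cov_mat M ?u ?u = G ** herm (cov_mat M ?u y)"
    using herm_cov_mat[OF sq sq_y] by (simp add: left[OF sq])
  also have "\<dots> = G ** Cyy ** herm G"
    by (simp add: left[OF sq_y] herm_mult herm_Cyy matrix_mul_assoc)
  finally show ?thesis using cov_mat_diag[OF sq, of i] by simp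
qed

text \<open>Positive definiteness of \<open>C\<^sub>y\<^sub>y\<close>: the form is the variance of \<open>(G y)\<^sub>i\<close>. If it vanishes, that component is uncorrelated
  with \<open>y\<close>, so row \<open>i\<close> of \<open>G C\<^sub>y\<^sub>y\<close> is zero, and \<open>C\<^sub>y\<^sub>y\<close> can be cancelled.\<close>

lemma quadratic_form_eq_0_imp_row_eq_0:
  assumes "(G ** Cyy ** herm G) $ i $ i = 0"
  shows "G $ i = 0"
proof -
  let ?u = "\<lambda>\<omega>. G *v y \<omega>"
  have sq: "square_integrable M ?u"
    by (rule square_integrable_linear[OF linear_matrix_vector_complex sq_y])
  have "cov_mat M ?u y $ i = 0"
    using assms cov_mat_row_eq_0_if_variance_0[OF sq sq_y, of i] by (simp add: quadratic_form_variance)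
  then have "(G ** Cyy) $ i = 0"
    using cov_mat_affine_left[OF sq_y sq_y, of G 0] by simp
  then have "(G ** Cyy ** matrix_inv Cyy) $ i = 0"
    by (simp add: vec_eq_iff matrix_matrix_mult_def)
  then show ?thesis by (simp add: matrix_inv_inverse[OF inv_Cyy] flip: matrix_mul_assoc)
qed

text \<open>The diagonal entry is the variance of the \<open>i\<close>-th component of the LMMSE estimate. It cannot vanish,
  for then \<open>x\<^sub>i\<close> would be uncorrelated with \<open>y\<close>. So the denominators in \<open>D\<close> are positive reals.\<close>

lemma A_diag_pos: "\<exists>a>0. A_CL M x y $ i $ i = of_real a"
proof -
  let ?v = "variance_c M (component (\<lambda>\<omega>. lmmse_gain *v y \<omega>) i)"
  have "?v \<noteq> 0"
  proof
    assume "?v = 0"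
    then have "lmmse_gain $ i = 0"
      using quadratic_form_eq_0_imp_row_eq_0[of lmmse_gain i] quadratic_form_variance[of lmmse_gain i] by simp
    then have "(lmmse_gain ** Cyy) $ i = 0" by (simp add: vec_eq_iff matrix_matrix_mult_def)
    then have "Cxy $ i $ j = 0" for j by (simp add: lmmse_gain_Cyy)
    then have "cnj (Cyx $ j $ i) = 0" for j using herm_Cyx by (metis herm_nth)
    then have "cov_mat M y (comp_vec x i) = 0"
      by (simp add: vec_eq_iff cov_nth_comp_vec)
    then show False using cross_nonzero by simp
  qed
  then have "?v > 0" using variance_c_nonneg[of "component (\<lambda>\<omega>. lmmse_gain *v y \<omega>) i"] by linarith
  then show ?thesis using A_eq(3) quadratic_form_variance[of lmmse_gain i] by auto
qed

lemma D_CL_nth: "D_CL M x y $ i $ j = (if i = j then of_real (variance_c M (component x i)) / A_CL M x y $ i $ i else 0)"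
  by (simp add: D_CL_def A_CL_def matrix_matrix_mult_def cov_nth_comp_vec)

lemma D_mult_nth: "(D_CL M x y ** B) $ i $ j = D_CL M x y $ i $ i * B $ i $ j"
proof -
  have "(D_CL M x y ** B) $ i $ j = (\<Sum>k\<in>UNIV. D_CL M x y $ i $ k * B $ k $ j)"
    by (simp add: matrix_matrix_mult_def)
  also have "\<dots> = (\<Sum>k\<in>UNIV. if k = i then D_CL M x y $ i $ i * B $ i $ j else 0)"
    by (rule sum.cong) (auto simp: D_CL_nth)
  finally show ?thesis by simp
qed

lemma D_real: "D_CL M x y $ i $ i \<in> \<real>"
  using A_diag_pos[of i] by (auto simp: D_CL_nth simp flip: of_real_divide)

lemma herm_D: "herm (D_CL M x y) = D_CL M x y"
  using D_real by (auto simp: vec_eq_iff D_CL_nth Reals_cnj_iff simp del: complex_cnj_divide)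

lemma D_A_diag: "(D_CL M x y ** A_CL M x y) $ i $ i = of_real (variance_c M (component x i))"
  using A_diag_pos[of i] by (auto simp: D_mult_nth D_CL_nth)

lemma E_CL_eq: "E_CL M x y = D_CL M x y ** lmmse_gain"
  by (simp add: E_CL_def matrix_mul_assoc)

lemma error_cov:
  "cov_mat M (\<lambda>\<omega>. x \<omega> - (F *v y \<omega> + c)) (\<lambda>\<omega>. x \<omega> - (F *v y \<omega> + c))
    = Cxx - Cxy ** herm F - F ** Cyx + F ** Cyy ** herm F"
proof -
  let ?e = "\<lambda>\<omega>. x \<omega> - (F *v y \<omega> + c)"
  have sq: "square_integrable M ?e"
    by (intro square_integrable_diff sq_x square_integrable_affine sq_y)
  have left: "cov_mat M ?e v = cov_mat M x v - F ** cov_mat M y v" if v: "square_integrable M v" for v :: "'w \<Rightarrow> complex^'k"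
    using cov_mat_diff_left[OF sq_x square_integrable_affine[OF sq_y] v] cov_mat_affine_left[OF sq_y v] by simp
  have "cov_mat M ?e ?e = herm (cov_mat M ?e x) - F ** herm (cov_mat M ?e y)"
    using herm_cov_mat[OF sq sq_x] herm_cov_mat[OF sq sq_y] by (simp add: left[OF sq])
  also have "\<dots> = Cxx - Cxy ** herm F - F ** (Cyx - Cyy ** herm F)"
    using herm_cov_mat[OF sq_x sq_x]
    by (simp add: left[OF sq_x] left[OF sq_y] herm_diff herm_mult herm_Cyx herm_Cxy herm_Cyy)
  finally show ?thesis by (simp add: matrix_diff_ldistrib matrix_mul_assoc)
qed

lemma bmse_eq_mse_mat_diag:
  "complex_of_real (bmse M x y (\<lambda>v. F *v v + c) i) = mse_mat M x y (\<lambda>v. F *v v + c) $ i $ i"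
proof -
  let ?e = "\<lambda>\<omega>. x \<omega> - (F *v y \<omega> + c)"
  have sq: "square_integrable M ?e"
    by (intro square_integrable_diff sq_x square_integrable_affine sq_y)
  have "integrable M (\<lambda>\<omega>. outer_H (?e \<omega>) (?e \<omega>))"
    by (rule square_integrable_bounded_bilinear[OF bounded_bilinear_outer_H sq sq])
  then have "mse_mat M x y (\<lambda>v. F *v v + c) $ i $ i = (CLINT \<omega>|M. outer_H (?e \<omega>) (?e \<omega>) $ i $ i)"
    by (simp add: mse_mat_def integral_vec_nth integrable_vec_nth)
  also have "\<dots> = (CLINT \<omega>|M. of_real ((cmod ((F *v y \<omega> + c) $ i - x \<omega> $ i))\<^sup>2))"
    unfolding outer_H_def by (simp only: norm_minus_commute[of "(F *v y _ + c) $ i"] complex_norm_square) simp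
  finally show ?thesis by (simp only: bmse_def integral_complex_of_real)
qed

lemma mean_error: "mean M (\<lambda>\<omega>. x \<omega> - (F *v y \<omega> + c)) = mean M x - (F *v mean M y + c)"
  unfolding mean_diff[OF integrable_x square_integrable_integrable[OF square_integrable_affine[OF sq_y]]]
    mean_affine[OF integrable_y] ..

lemma mse_mat_eq:
  "mse_mat M x y (\<lambda>v. F *v v + c) = Cxx - Cxy ** herm F - F ** Cyx + F ** Cyy ** herm F
    + outer_H (mean M x - (F *v mean M y + c)) (mean M x - (F *v mean M y + c))"
  unfolding mse_mat_def
  using second_moment_eq_cov_plus_mean[OF square_integrable_diff[OF sq_x square_integrable_affine[OF sq_y]]]
  by (simp add: error_cov mean_error)

text \<open>By the regression formula the conditional expectation is an affine function of \<open>x\<^sub>i\<close>; it equals \<open>x\<^sub>i\<close>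
  almost surely only if its slope is \<open>1\<close> and its mean is right, since \<open>x\<^sub>i\<close> is not almost surely constant.\<close>

lemma cond_unbiased_affine_iff:
  "cond_unbiased M x y (\<lambda>v. F *v v + c) i \<longleftrightarrow>
     (F *v mean M y + c) $ i = mean M x $ i \<and> (F ** Cyx) $ i $ i = of_real (variance_c M (component x i))"
proof -
  let ?X = "component x i" and ?Y = "\<lambda>\<omega>. (F *v y \<omega> + c) $ i"
  define s where "s = variance_c M ?X"
  have s: "s > 0" by (simp add: s_def var_pos)
  define \<alpha> where "\<alpha> = (F ** Cyx) $ i $ i / of_real s"
  have iX: "integrable M ?X" unfolding component_def by (rule integrable_vec_nth[OF integrable_x])
  have EX: "expectation ?X = mean M x $ i" by (rule mean_nth[OF integrable_x, symmetric])
  have EY: "expectation ?Y = (F *v mean M y + c) $ i"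
    using mean_nth[OF square_integrable_integrable[OF square_integrable_affine[OF sq_y]], of F c i]
    by (simp add: mean_affine[OF integrable_y] component_def)
  have reg: "AE \<omega> in M. cond_exp_given M ?X ?Y \<omega> = expectation ?Y + \<alpha> * (?X \<omega> - expectation ?X)"
  proof (rule cond_exp_given_proper_gaussian)
    fix a b
    let ?f = "\<lambda>z :: complex^('n + 'm). Re (a * z $ Inl i + b * (\<Sum>j\<in>UNIV. F $ i $ j * z $ Inr j))"
    have "linear ?f"
    proof (rule linearI)
      fix u v :: "complex^('n + 'm)" and r :: real
      show "?f (u + v) = ?f u + ?f v"
        by (simp add: distrib_left sum.distrib del: times_complex.sel)
      show "?f (r *\<^sub>R u) = r *\<^sub>R ?f u"
        by (simp add: scaleR_sum_right[symmetric] distrib_left del: times_complex.sel)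
    qed
    from gaussian_real_shift[OF gaussian_vec_linear[OF gaussian_stack this], of "Re (b * c $ i)"]
    show "gaussian_real M (\<lambda>\<omega>. Re (a * ?X \<omega> + b * ?Y \<omega>))"
      by (simp add: stack_def component_def matrix_vector_mult_def distrib_left add.assoc del: times_complex.sel)
  next
    show "expectation (\<lambda>\<omega>. (?X \<omega> - expectation ?X) * (?X \<omega> - expectation ?X)) = 0"
      unfolding EX using pseudo_x_x by (simp add: component_def)
  next
    have int: "integrable M (\<lambda>\<omega>. (x \<omega> $ i - mean M x $ i) * (y \<omega> $ j - mean M y $ j))" for j
    proof -
      have lin: "linear (\<lambda>z :: complex^'k. z $ k)" for k by (auto intro: linearI)
      show ?thesis
        by (intro square_integrable_bounded_bilinear[OF bounded_bilinear_mult] square_integrable_diff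
            square_integrable_linear[OF lin] sq_x sq_y square_integrable_const)
    qed
    have "?Y \<omega> - expectation ?Y = (\<Sum>j\<in>UNIV. F $ i $ j * (y \<omega> $ j - mean M y $ j))" for \<omega>
      unfolding EY by (simp add: matrix_vector_mult_def right_diff_distrib sum_subtractf)
    then have "expectation (\<lambda>\<omega>. (?X \<omega> - expectation ?X) * (?Y \<omega> - expectation ?Y))
      = expectation (\<lambda>\<omega>. \<Sum>j\<in>UNIV. F $ i $ j * ((x \<omega> $ i - mean M x $ i) * (y \<omega> $ j - mean M y $ j)))"
      unfolding EX by (simp add: component_def sum_distrib_left mult.left_commute)
    also have "\<dots> = 0" using int by (simp add: pseudo_x_y)
    finally show "expectation (\<lambda>\<omega>. (?X \<omega> - expectation ?X) * (?Y \<omega> - expectation ?Y)) = 0" .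
  next
    have "expectation (\<lambda>\<omega>. (?Y \<omega> - expectation ?Y) * cnj (?X \<omega> - expectation ?X)) = cov_mat M (\<lambda>\<omega>. F *v y \<omega> + c) x $ i $ i"
      unfolding EX EY using cov_mat_nth[OF square_integrable_affine[OF sq_y] sq_x, of F c i i]
      by (simp add: component_def mean_affine[OF integrable_y])
    then show "expectation (\<lambda>\<omega>. (?Y \<omega> - expectation ?Y) * cnj (?X \<omega> - expectation ?X)) = \<alpha> * of_real (variance_c M ?X)"
      using s by (simp add: cov_mat_affine_left[OF sq_y sq_x] \<alpha>_def s_def)
  qed
  have iff: "cond_unbiased M x y (\<lambda>v. F *v v + c) i \<longleftrightarrow>
    (AE \<omega> in M. expectation ?Y + \<alpha> * (?X \<omega> - expectation ?X) = ?X \<omega>)"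
    unfolding cond_unbiased_def using reg by (auto simp: component_def elim: AE_mp)
  show ?thesis
  proof
    assume "(F *v mean M y + c) $ i = mean M x $ i \<and> (F ** Cyx) $ i $ i = of_real (variance_c M ?X)"
    then have "expectation ?Y = expectation ?X" "\<alpha> = 1" using s EX EY by (simp_all add: \<alpha>_def s_def)
    then show "cond_unbiased M x y (\<lambda>v. F *v v + c) i" unfolding iff by simp
  next
    assume "cond_unbiased M x y (\<lambda>v. F *v v + c) i"
    then have ae: "AE \<omega> in M. expectation ?Y + \<alpha> * (?X \<omega> - expectation ?X) = ?X \<omega>" by (simp only: iff)
    have [measurable]: "?X \<in> borel_measurable M" using iX by auto
    have "expectation (\<lambda>\<omega>. expectation ?Y + \<alpha> * (?X \<omega> - expectation ?X)) = expectation ?X"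
      by (rule integral_cong_AE) (use ae in auto)
    then have eq: "expectation ?Y = expectation ?X" using iX by (simp add: prob_space)
    have "\<alpha> = 1"
    proof (rule ccontr)
      assume "\<alpha> \<noteq> 1"
      have "AE \<omega> in M. (cmod (?X \<omega> - expectation ?X))\<^sup>2 = 0"
        using ae
      proof eventually_elim
        case (elim \<omega>)
        then have "(\<alpha> - 1) * (?X \<omega> - expectation ?X) = 0" unfolding eq by (simp add: algebra_simps)
        then show ?case using \<open>\<alpha> \<noteq> 1\<close> by simp
      qed
      then have "s = 0" unfolding s_def variance_c_def by (rule integral_eq_zero_AE)
      then show False using s by simp
    qed
    then show "(F *v mean M y + c) $ i = mean M x $ i \<and> (F ** Cyx) $ i $ i = of_real (variance_c M ?X)"
      using eq s EX EY by (simp add: \<alpha>_def s_def field_simps)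
  qed
qed

text \<open>The constraint fixes both cross terms of the error variance at \<open>\<sigma>\<^sup>2\<close> and removes the bias.\<close>

lemma bmse_of_cond_unbiased:
  assumes "cond_unbiased M x y (\<lambda>v. F *v v + c) i"
  shows "complex_of_real (bmse M x y (\<lambda>v. F *v v + c) i)
    = (F ** Cyy ** herm F) $ i $ i - of_real (variance_c M (component x i))"
proof -
  have m: "(F *v mean M y + c) $ i = mean M x $ i" and f: "(F ** Cyx) $ i $ i = of_real (variance_c M (component x i))"
    using assms by (simp_all add: cond_unbiased_affine_iff)
  have "(Cxy ** herm F) $ i $ i = cnj ((F ** Cyx) $ i $ i)"
    using herm_mult[of F Cyx] herm_Cyx by (metis herm_nth)
  then have "(Cxy ** herm F) $ i $ i = of_real (variance_c M (component x i))" by (simp add: f)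
  then show ?thesis
    using m f by (simp add: bmse_eq_mse_mat_diag mse_mat_eq cov_mat_diag[OF sq_x] outer_H_def)
qed

lemma x_CL_affine: "x_CL M x y = (\<lambda>v. E_CL M x y *v v + (mean M x - E_CL M x y *v mean M y))"
  by (auto simp: x_CL_def matrix_vector_mult_diff_distrib)

lemma x_CL_cond_unbiased: "cond_unbiased M x y (x_CL M x y) i"
  unfolding x_CL_affine cond_unbiased_affine_iff
  using D_A_diag[of i] by (simp add: E_CL_eq A_eq(1) matrix_mul_assoc)

text \<open>Pythagoras: the difference \<open>\<Delta>\<close> of two admissible gain matrices satisfies \<open>(\<Delta> C\<^sub>y\<^sub>x)\<^sub>i\<^sub>i = 0\<close>, and the cross term is a
  multiple of this number because \<open>E\<^sub>C\<^sub>L C\<^sub>y\<^sub>y = D C\<^sub>x\<^sub>y\<close> with \<open>D\<close> diagonal.\<close>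

lemma bmse_excess:
  assumes h: "cond_unbiased M x y (\<lambda>v. F *v v + c) i"
  shows "bmse M x y (\<lambda>v. F *v v + c) i = bmse M x y (x_CL M x y) i
    + variance_c M (component (\<lambda>\<omega>. (F - E_CL M x y) *v y \<omega>) i)"
proof -
  let ?E = "E_CL M x y" and ?\<Delta> = "F - E_CL M x y"
  have "(F ** Cyx) $ i $ i = (?E ** Cyx) $ i $ i"
    using h x_CL_cond_unbiased[of i] by (simp add: x_CL_affine cond_unbiased_affine_iff)
  then have \<Delta>: "(?\<Delta> ** Cyx) $ i $ i = 0" by (simp add: matrix_diff_rdistrib)
  have cross: "(?E ** Cyy ** herm ?\<Delta>) $ i $ i = 0"
  proof -
    have "?E ** Cyy ** herm ?\<Delta> = D_CL M x y ** (Cxy ** herm ?\<Delta>)"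
      by (simp add: E_CL_eq lmmse_gain_Cyy flip: matrix_mul_assoc) (simp add: matrix_mul_assoc lmmse_gain_Cyy)
    moreover have "(Cxy ** herm ?\<Delta>) $ i $ i = cnj ((?\<Delta> ** Cyx) $ i $ i)"
      using herm_mult[of ?\<Delta> Cyx] herm_Cyx by (metis herm_nth)
    ultimately show ?thesis using \<Delta> by (simp add: D_mult_nth)
  qed
  then have cross': "(?\<Delta> ** Cyy ** herm ?E) $ i $ i = 0"
  proof -
    have "herm (?E ** Cyy ** herm ?\<Delta>) = ?\<Delta> ** Cyy ** herm ?E"
      by (simp add: herm_mult herm_Cyy matrix_mul_assoc)
    then have "(?\<Delta> ** Cyy ** herm ?E) $ i $ i = cnj ((?E ** Cyy ** herm ?\<Delta>) $ i $ i)" by (metis herm_nth)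
    then show ?thesis by (simp add: cross)
  qed
  have "F ** Cyy ** herm F = (?E + ?\<Delta>) ** Cyy ** herm (?E + ?\<Delta>)" by simp
  also have "\<dots> = ?E ** Cyy ** herm ?E + ?E ** Cyy ** herm ?\<Delta> + ?\<Delta> ** Cyy ** herm ?E + ?\<Delta> ** Cyy ** herm ?\<Delta>"
    by (simp only: herm_add matrix_add_ldistrib matrix_add_rdistrib add.assoc) (simp add: add.left_commute)
  finally have "(F ** Cyy ** herm F) $ i $ i = (?E ** Cyy ** herm ?E) $ i $ i + (?\<Delta> ** Cyy ** herm ?\<Delta>) $ i $ i"
    by (simp add: cross cross')
  then have "complex_of_real (bmse M x y (\<lambda>v. F *v v + c) i) = complex_of_real (bmse M x y (x_CL M x y) i
    + variance_c M (component (\<lambda>\<omega>. ?\<Delta> *v y \<omega>) i))"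
    using bmse_of_cond_unbiased[OF h] bmse_of_cond_unbiased[OF x_CL_cond_unbiased[unfolded x_CL_affine], of i]
    by (simp add: x_CL_affine quadratic_form_variance)
  then show ?thesis by (simp only: of_real_eq_iff)
qed

text \<open>The excess formula shows \<open>x_CL\<close> to be optimal in all components simultaneously, so any other
  optimal estimator has excess \<open>0\<close> in each of them. This forces the rows of its gain matrix; the mean
  condition then forces its offset.\<close>

lemma is_cwcu_lmmse_iff: "is_cwcu_lmmse M x y g \<longleftrightarrow> g = x_CL M x y"
proof
  have aff: "affine_estimator (x_CL M x y)"
    unfolding affine_estimator_def x_CL_affine by blast
  {
    assume "g = x_CL M x y"
    then show "is_cwcu_lmmse M x y g"
      unfolding is_cwcu_lmmse_def
    proof (intro conjI allI impI, goal_cases)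
      case (3 i h)
      then obtain F c where "h = (\<lambda>v. F *v v + c)" by (auto simp: affine_estimator_def)
      then show ?case using 3 bmse_excess[of F c i] variance_c_nonneg by simp
    qed (use aff x_CL_cond_unbiased in auto)
  }
  assume g: "is_cwcu_lmmse M x y g"
  then obtain F c where "\<forall>v. g v = F *v v + c"
    unfolding is_cwcu_lmmse_def affine_estimator_def by blast
  then have gF: "g = (\<lambda>v. F *v v + c)" by (simp add: fun_eq_iff)
  have cu: "cond_unbiased M x y (\<lambda>v. F *v v + c) i" for i
    using g by (simp add: is_cwcu_lmmse_def gF)
  have "(F - E_CL M x y) $ i = 0" for i
  proof (rule quadratic_form_eq_0_imp_row_eq_0)
    have "bmse M x y g i \<le> bmse M x y (x_CL M x y) i"
      using g aff x_CL_cond_unbiased by (simp add: is_cwcu_lmmse_def)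
    then have "variance_c M (component (\<lambda>\<omega>. (F - E_CL M x y) *v y \<omega>) i) = 0"
      using bmse_excess[OF cu] variance_c_nonneg[of "component (\<lambda>\<omega>. (F - E_CL M x y) *v y \<omega>) i"] gF by simp
    then show "((F - E_CL M x y) ** Cyy ** herm (F - E_CL M x y)) $ i $ i = 0"
      by (simp add: quadratic_form_variance)
  qed
  then have F: "F = E_CL M x y" by (simp add: vec_eq_iff)
  have "F *v mean M y + c = mean M x"
    using cu by (simp add: vec_eq_iff cond_unbiased_affine_iff)
  then have "c = mean M x - E_CL M x y *v mean M y" by (simp add: F algebra_simps)
  then show "g = x_CL M x y" by (simp add: gF F x_CL_affine)
qed

lemma mean_error_CL: "mean M (\<lambda>\<omega>. x \<omega> - x_CL M x y (y \<omega>)) = 0"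
  by (simp add: x_CL_affine mean_error)

lemma mse_mat_CL_eq_cov: "cov_mat M (\<lambda>\<omega>. x \<omega> - x_CL M x y (y \<omega>)) (\<lambda>\<omega>. x \<omega> - x_CL M x y (y \<omega>))
    = mse_mat M x y (x_CL M x y)"
  by (simp add: x_CL_affine error_cov mse_mat_eq outer_H.zero_left)

lemma mse_mat_CL: "mse_mat M x y (x_CL M x y) = cov_mat M x x - A_CL M x y ** D_CL M x y - D_CL M x y ** A_CL M x y
          + D_CL M x y ** A_CL M x y ** D_CL M x y"
proof -
  have herm_E: "herm (D_CL M x y ** lmmse_gain) = herm lmmse_gain ** D_CL M x y"
    by (simp only: herm_mult[of "D_CL M x y" lmmse_gain] herm_D)
  have "mse_mat M x y (x_CL M x y) = Cxx - Cxy ** herm (D_CL M x y ** lmmse_gain) - D_CL M x y ** lmmse_gain ** Cyx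
    + (D_CL M x y ** lmmse_gain) ** Cyy ** herm (D_CL M x y ** lmmse_gain)"
    by (simp add: x_CL_affine mse_mat_eq outer_H.zero_left E_CL_eq)
  also have "\<dots> = Cxx - (Cxy ** herm lmmse_gain) ** D_CL M x y - D_CL M x y ** (lmmse_gain ** Cyx)
    + D_CL M x y ** (lmmse_gain ** Cyy ** herm lmmse_gain) ** D_CL M x y"
    unfolding herm_E by (simp only: matrix_mul_assoc)
  finally show ?thesis unfolding A_eq(1)[symmetric] A_eq(2)[symmetric] A_eq(3)[symmetric] .
qed

end

theorem proposition1:
  fixes M :: "'w measure"
    and x :: "'w \<Rightarrow> complex^'n"
    and y :: "'w \<Rightarrow> complex^'m"
  assumes "prob_space M"
    and "jointly_proper_gaussian M x y"
    and "invertible (cov_mat M y y)"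
    and "\<And>i. variance_c M (component x i) > 0"
    and "\<And>i. cov_mat M y (comp_vec x i) \<noteq> 0"
  shows "(\<forall>g. is_cwcu_lmmse M x y g \<longleftrightarrow> g = x_CL M x y)
    \<and> (\<forall>i. D_CL M x y $ i $ i \<in> \<real>)
    \<and> mean M (\<lambda>\<omega>. x \<omega> - x_CL M x y (y \<omega>)) = 0
    \<and> cov_mat M (\<lambda>\<omega>. x \<omega> - x_CL M x y (y \<omega>)) (\<lambda>\<omega>. x \<omega> - x_CL M x y (y \<omega>))
        = mse_mat M x y (x_CL M x y)
    \<and> mse_mat M x y (x_CL M x y)
        = cov_mat M x x - A_CL M x y ** D_CL M x y - D_CL M x y ** A_CL M x y
          + D_CL M x y ** A_CL M x y ** D_CL M x y
    \<and> (\<forall>i. complex_of_real (bmse M x y (x_CL M x y) i) = mse_mat M x y (x_CL M x y) $ i $ i)"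
proof -
  interpret prob_space M by fact
  interpret proper_gaussian_model M x y
    using assms(2-) by unfold_locales auto
  have "complex_of_real (bmse M x y (x_CL M x y) i) = mse_mat M x y (x_CL M x y) $ i $ i" for i
    unfolding x_CL_affine by (rule bmse_eq_mse_mat_diag)
  then show ?thesis
    using is_cwcu_lmmse_iff D_real mean_error_CL mse_mat_CL_eq_cov mse_mat_CL by blast
qed

end
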